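(* Let $F$ be differentiable and strongly convex with parameter $\mu_F>0$ over $\mathscr B$ with respect to $\|\cdot\|$, with gradients Lipschitz with parameter $\mathfrak L_F>0$, and let $\beta^*$ be its unique minimizer over $\mathscr B$. Let $\{\beta_t\}$ be generated by the randomized block gradient stochastic mirror descent scheme with stepsizes $\eta_t>0$: $\beta_{t+1}^i=\mathcal P_{i_t}(\beta_t^{i_t},\eta_tg_{i_t}(\beta_t))$ if $i=i_t$, and $\beta_{t+1}^i=\beta_t^i$ if $i\ne i_t$, for $t\ge0$. Suppose the stochastic errors $z_t=g(\beta_t)-\nabla F(\beta_t)$ satisfy a.s. $\mathbb E[z_t\mid\mathcal F_t]=0$ for all $t\ge0$, and that for each $i$ there is $\nu_i>0$ with $\mathbb E[\|z_t^i\|_{*i}^2\mid\mathcal F_t]\le\nu_i^2$ for all $t\ge0$. Then a.s. for all $t\ge0$, $$\mathbb E[\mathcal L(\beta_{t+1},\beta^* )\mid\mathcal F_t]\le\left(1-\eta_t\frac{2\mu_Fp_\wedge}{\mathfrak L_{max}}+\eta_t^2\frac{2\mathfrak L_F^2p_\vee}{\mu_{min}^2}\right)\mathcal L(\beta_t,\beta^* )+\eta_t^2\sum_{i=1}^l\frac{\nu_i^2}{\mu_{\omega_i}}.$$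
   Context: Problem: minimize $F(\beta):=\mathbb E[f(\beta,\xi)]$ over $\beta\in\mathscr B=\prod_{i=1}^l\mathscr B_i\subset\mathbb R^n$, with $\mathscr B_i\subset\mathbb R^{n_i}$ nonempty, closed, convex, $n=\sum_i n_i$, $f:\mathscr B\times\Omega\to\mathbb R$, and $\xi:\Omega\to\mathbb R^d$ a random vector on a probability space. Norms: $\beta^i\in\mathbb R^{n_i}$ is the $i$th block of $\beta$, and a subscript $i$ denotes the $i$th block of a mapping into $\mathbb R^n$. $\|\cdot\|_i$ is a general norm on $\mathbb R^{n_i}$ with dual norm $\|\cdot\|_{*i}$; $\langle u,v\rangle=\sum_i\langle u^i,v^i\rangle$; $\|x\|^2=\sum_{i=1}^l\|x^i\|_i^2$, with dual norm $\|\cdot\|_*$. $F$ strongly convex with parameter $\mu_F$: $F(\beta_1)\ge F(\beta_2)+\langle\nabla F(\beta_2),\beta_1-\beta_2\rangle+\frac{\mu_F}{2}\|\beta_1-\beta_2\|^2$ for all $\beta_1,\beta_2\in\mathscr B$ (then $F$ has a unique minimizer over $\mathscr B$). Lipschitz gradients: $\|\nabla F(\beta_1)-\nabla F(\beta_2)\|_*\le\mathfrak L_F\|\beta_1-\beta_2\|$ for $\beta_1,\beta_2\in\mathscr B$. Mirror maps: $\omega_i:\mathbb R^{n_i}\to\mathbb R$ is continuously differentiable, with Bregman divergence $D_i(\beta_1,\beta_2)=D_{\omega_i}(\beta_1,\beta_2)=\omega_i(\beta_2)-\omega_i(\beta_1)-\langle\nabla\omega_i(\beta_1),\beta_2-\beta_1\rangle$.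 It is assumed that $\omega_i$ has Lipschitz gradients with parameter $\mathfrak L_{\omega_i}$ and is strongly convex with parameter $\mu_{\omega_i}>0$, i.e. $\frac{\mu_{\omega_i}}2\|\beta_2-\beta_1\|_i^2\le D_{\omega_i}(\beta_1,\beta_2)\le\frac{\mathfrak L_{\omega_i}}2\|\beta_2-\beta_1\|_i^2$ for $\beta_1,\beta_2\in\mathscr B_i$. Prox mapping: $\mathcal P_i(\beta_1,\beta_2)=\operatorname{argmin}_{z\in\mathscr B_i}\{\langle\beta_2,z\rangle+D_i(\beta_1,z)\}$ for $\beta_1\in\mathscr B_i$, $\beta_2\in\mathbb R^{n_i}$. Error function: $\mathcal L(\beta,z)=\sum_{i=1}^l p_i^{-1}D_i(\beta^i,z^i)$. Sampling: $p_i>0$, $\sum_{i=1}^l p_i=1$; the initial vector $\beta_0\in\mathscr B$ is given; at iteration $t$ the block index $i_t$ is drawn with $\mathrm{Prob}(i_t=i)=p_i$, independently of $\xi_t$ and of the past; $\xi_t$ is a copy of $\xi$ independent of the past; $g(\beta_t)$ is the gradient of $f(\cdot,\xi_t)$ at $\beta_t$, with $i$th block $g_i(\beta_t)$. The stepsizes are deterministic. $\mathcal F_t=\{i_0,\xi_0,\dots,i_{t-1},\xi_{t-1}\}$. $p_\wedge=\min_ip_i$, $p_\vee=\max_ip_i$, $\mathfrak L_{max}=\max_i\mathfrak L_{\omega_i}$, $\mu_{min}=\min_i\mu_{\omega_i}$. *)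

theory Defs
  imports "HOL-Probability.Probability"
begin

text \<open>
  The coordinates of \<open>real ^ 'n\<close> are grouped into blocks by a map \<open>c :: 'n \<Rightarrow> 'l\<close> into a finite
  index type. The \<open>i\<close>th factor, of dimension \<open>card (c -` {i})\<close>, is represented by the
  coordinate subspace \<open>block_space c i\<close>, so that all blocks live in one type although their
  dimensions may differ.
\<close>

definition block_space :: "('n::finite \<Rightarrow> 'l) \<Rightarrow> 'l \<Rightarrow> (real ^ 'n) set" where
  "block_space c i = {x. \<forall>j. c j \<noteq> i \<longrightarrow> x $ j = 0}"

definition block :: "('n::finite \<Rightarrow> 'l) \<Rightarrow> 'l \<Rightarrow> real ^ 'n \<Rightarrow> real ^ 'n" where
  "block c i x = (\<chi> j. if c j = i then x $ j else 0)"

definition block_prod :: "('n::finite \<Rightarrow> 'l) \<Rightarrow> ('l \<Rightarrow> (real ^ 'n) set) \<Rightarrow> (real ^ 'n) set" where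
  "block_prod c B = {x. \<forall>i. block c i x \<in> B i}"

definition is_norm_on :: "'a::real_vector set \<Rightarrow> ('a \<Rightarrow> real) \<Rightarrow> bool" where
  "is_norm_on V N \<longleftrightarrow>
     (\<forall>x\<in>V. 0 \<le> N x) \<and> (\<forall>x\<in>V. N x = 0 \<longleftrightarrow> x = 0) \<and>
     (\<forall>x\<in>V. \<forall>a. N (a *\<^sub>R x) = \<bar>a\<bar> * N x) \<and> (\<forall>x\<in>V. \<forall>y\<in>V. N (x + y) \<le> N x + N y)"

definition dual_norm_on :: "'a::real_inner set \<Rightarrow> ('a \<Rightarrow> real) \<Rightarrow> 'a \<Rightarrow> real" where
  "dual_norm_on V N u = Sup {u \<bullet> v | v. v \<in> V \<and> N v \<le> 1}"

definition block_norm ::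
  "('n::finite \<Rightarrow> 'l::finite) \<Rightarrow> ('l \<Rightarrow> real ^ 'n \<Rightarrow> real) \<Rightarrow> real ^ 'n \<Rightarrow> real" where
  "block_norm c N x = sqrt (\<Sum>i\<in>UNIV. (N i (block c i x))\<^sup>2)"

text \<open>\<open>dw\<close> is the gradient map of \<open>w\<close>; the first point \<open>x\<close> is the base point.\<close>

definition bregman :: "('a::real_inner \<Rightarrow> real) \<Rightarrow> ('a \<Rightarrow> 'a) \<Rightarrow> 'a \<Rightarrow> 'a \<Rightarrow> real" where
  "bregman w dw x y = w y - w x - dw x \<bullet> (y - x)"

definition prox ::
  "'a::real_inner set \<Rightarrow> ('a \<Rightarrow> real) \<Rightarrow> ('a \<Rightarrow> 'a) \<Rightarrow> 'a \<Rightarrow> 'a \<Rightarrow> 'a" where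
  "prox S w dw x v = arg_min_on (\<lambda>z. v \<bullet> z + bregman w dw x z) S"

definition error_fun ::
  "('n::finite \<Rightarrow> 'l::finite) \<Rightarrow> ('l \<Rightarrow> real) \<Rightarrow> ('l \<Rightarrow> real ^ 'n \<Rightarrow> real) \<Rightarrow>
   ('l \<Rightarrow> real ^ 'n \<Rightarrow> real ^ 'n) \<Rightarrow> real ^ 'n \<Rightarrow> real ^ 'n \<Rightarrow> real" where
  "error_fun c p w dw x z =
     (\<Sum>i\<in>UNIV. inverse (p i) * bregman (w i) (dw i) (block c i x) (block c i z))"

text \<open>
  Randomized block mirror descent along the sampled blocks \<open>ix t\<close> and samples \<open>xi t\<close>, with
  stepsizes \<open>\<eta> t\<close>, stochastic gradient \<open>G b x\<close> at the point \<open>b\<close> for the sample \<open>x\<close>, and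
  initial vector \<open>b0\<close>.
\<close>

primrec rbsmd ::
  "('n::finite \<Rightarrow> 'l) \<Rightarrow> ('l \<Rightarrow> (real ^ 'n) set) \<Rightarrow> ('l \<Rightarrow> real ^ 'n \<Rightarrow> real) \<Rightarrow>
   ('l \<Rightarrow> real ^ 'n \<Rightarrow> real ^ 'n) \<Rightarrow> (nat \<Rightarrow> real) \<Rightarrow> (real ^ 'n \<Rightarrow> 's \<Rightarrow> real ^ 'n) \<Rightarrow>
   (nat \<Rightarrow> 'w \<Rightarrow> 'l) \<Rightarrow> (nat \<Rightarrow> 'w \<Rightarrow> 's) \<Rightarrow> real ^ 'n \<Rightarrow> nat \<Rightarrow> 'w \<Rightarrow> real ^ 'n" where
  "rbsmd c B w dw \<eta> G ix xi b0 0 = (\<lambda>\<omega>. b0)"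
| "rbsmd c B w dw \<eta> G ix xi b0 (Suc t) = (\<lambda>\<omega>.
     let b = rbsmd c B w dw \<eta> G ix xi b0 t \<omega>;
         i = ix t \<omega>;
         q = prox (B i) (w i) (dw i) (block c i b) (\<eta> t *\<^sub>R block c i (G b (xi t \<omega>)))
     in (\<chi> j. if c j = i then q $ j else b $ j))"

text \<open>The sigma-algebra generated by \<open>ix s\<close> for \<open>s \<in> I\<close> and \<open>xi s\<close> for \<open>s \<in> J\<close>.\<close>

definition sample_algebra ::
  "'w measure \<Rightarrow> (nat \<Rightarrow> 'w \<Rightarrow> 'l) \<Rightarrow> (nat \<Rightarrow> 'w \<Rightarrow> 's::topological_space) \<Rightarrow>
   nat set \<Rightarrow> nat set \<Rightarrow> 'w measure" where
  "sample_algebra M ix xi I J = sigma (space M)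
     ({ix s -` A \<inter> space M | s A. s \<in> I} \<union>
      {xi s -` A \<inter> space M | s A. s \<in> J \<and> A \<in> sets borel})"

abbreviation past_algebra ::
  "'w measure \<Rightarrow> (nat \<Rightarrow> 'w \<Rightarrow> 'l) \<Rightarrow> (nat \<Rightarrow> 'w \<Rightarrow> 's::topological_space) \<Rightarrow> nat \<Rightarrow> 'w measure" where
  "past_algebra M ix xi t \<equiv> sample_algebra M ix xi {..<t} {..<t}"

end

theory Submission
  imports Defs
begin

text \<open>
  By the variational inequality at the minimizer, the block \<open>u\<close> of \<open>\<nabla>F(\<beta>star)\<close> may be subtracted from
  the stochastic gradient in the prox inequality even though it need not vanish: with \<open>q\<close> the prox
  point of \<open>x\<close> for \<open>v\<close>,
  \<open>D(q, y) \<le> D(x, y) + \<langle>v - u, y - x\<rangle> + \<parallel>v - u\<parallel>\<^sup>2 / (2 \<mu>)\<close>. Weighted by \<open>1 / p\<^sub>i\<close> and averaged over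
  the block index, which is independent of the past and of the current sample, this leaves
  \<open>\<langle>g - \<nabla>F(\<beta>star), \<beta>star - \<beta>\<^sub>t\<rangle>\<close> and a quadratic term. Split \<open>g = \<nabla>F(\<beta>\<^sub>t) + z\<^sub>t\<close>: strong convexity
  bounds the linear term, the Lipschitz condition and the variance bound the quadratic one, and the
  part linear in \<open>z\<^sub>t\<close> has conditional mean 0.
\<close>

section \<open>Norms on subspaces and their duals\<close>

text \<open>Two obstacles lie outside the inequality itself. The rules for
  \<open>real_cond_exp\<close> need integrable functions, and integrability of the error function at
  \<open>\<beta> t\<close> is not given, so it is carried along the iteration: strong convexity of
  the mirror maps turns it into square integrability of \<open>\<beta> t - \<beta>star\<close>, the
  Lipschitz condition does the same for the gradient difference, and together with the variance
  bound this gives integrability one step later. Besides, the norms are arbitrary and live on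
  coordinate subspaces only; measurability and integrability are reached by comparison with the
  Euclidean norm, and measurability of the iterates by continuity of the prox mapping.

  In a general dual norm the cross term between noise and gradient difference need not vanish in
  conditional mean. It is absorbed by
  \<open>(a + b)\<^sup>2 \<le> 2 * (a\<^sup>2 + b\<^sup>2)\<close>, whose 2 cancels the one in
  \<open>1 / (2 * \<mu>)\<close>; the 2 left in front of \<open>LF\<^sup>2\<close> stems from the
  factor 1/2 in strong convexity of the mirror maps.\<close>

locale normed_subspace =
  fixes V :: "'a::euclidean_space set" and N :: "'a \<Rightarrow> real"
  assumes subspace: "subspace V" and norm_on: "is_norm_on V N"
begin

abbreviation dual :: "'a \<Rightarrow> real" where "dual \<equiv> dual_norm_on V N"

lemma N_nonneg: "x \<in> V \<Longrightarrow> 0 \<le> N x"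
  and N_eq_0_iff: "x \<in> V \<Longrightarrow> N x = 0 \<longleftrightarrow> x = 0"
  and N_scaleR: "x \<in> V \<Longrightarrow> N (a *\<^sub>R x) = \<bar>a\<bar> * N x"
  and N_triangle: "x \<in> V \<Longrightarrow> y \<in> V \<Longrightarrow> N (x + y) \<le> N x + N y"
  using norm_on unfolding is_norm_on_def by auto

lemma N_zero [simp]: "N 0 = 0"
  using N_eq_0_iff subspace_0[OF subspace] by auto

lemma N_minus: "x \<in> V \<Longrightarrow> N (- x) = N x"
  using N_scaleR[of x "-1"] by simp

lemma N_minus_commute: "x \<in> V \<Longrightarrow> y \<in> V \<Longrightarrow> N (x - y) = N (y - x)"
  using N_minus[of "y - x"] subspace_diff[OF subspace, of y x] by simp

lemma N_sum_le:
  assumes "finite A" "\<And>a. a \<in> A \<Longrightarrow> g a \<in> V"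
  shows "N (sum g A) \<le> (\<Sum>a\<in>A. N (g a))"
  using assms
proof (induction A)
  case (insert a A)
  then have "sum g A \<in> V"
    by (auto intro: subspace_sum[OF subspace])
  with insert N_triangle[of "g a" "sum g A"] show ?case
    by fastforce
qed simp

text \<open>Expand in an orthonormal basis of \<open>V\<close>; Cauchy-Schwarz bounds each
  coefficient by \<open>norm x\<close>. The added 1 keeps the constant positive when
  \<open>V\<close> is trivial and the basis empty.\<close>

lemma N_le_norm: "\<exists>C>0. \<forall>x\<in>V. N x \<le> C * norm x"
proof -
  obtain B where B: "B \<subseteq> V" "pairwise orthogonal B" "\<And>x. x \<in> B \<Longrightarrow> norm x = 1"
    "independent B" "span B = V"
    using orthonormal_basis_subspace[OF subspace] by metis
  have fin: "finite B"
    using B(4) independent_imp_finite by blast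
  have NB: "0 \<le> N b" if "b \<in> B" for b
    using that B(1) N_nonneg by auto
  have "N x \<le> (1 + (\<Sum>b\<in>B. N b)) * norm x" if "x \<in> V" for x
  proof -
    have "N x = N (\<Sum>b\<in>B. (b \<bullet> x) *\<^sub>R b)"
      using orthonormal_basis_expand[OF B(2,3), of x] that B(5) fin by (simp add: inner_commute)
    also have "\<dots> \<le> (\<Sum>b\<in>B. N ((b \<bullet> x) *\<^sub>R b))"
      using B(1) fin subspace by (intro N_sum_le) (auto simp: subspace_scale)
    also have "\<dots> \<le> (\<Sum>b\<in>B. N b * norm x)"
    proof (rule sum_mono)
      fix b assume b: "b \<in> B"
      have "\<bar>b \<bullet> x\<bar> \<le> norm x"
        using Cauchy_Schwarz_ineq2[of b x] B(3)[OF b] by simp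
      then show "N ((b \<bullet> x) *\<^sub>R b) \<le> N b * norm x"
        using N_scaleR[of b] B(1) b NB[OF b] by (auto simp: mult.commute mult_left_mono)
    qed
    also have "\<dots> \<le> (1 + (\<Sum>b\<in>B. N b)) * norm x"
      by (simp add: sum_distrib_right[symmetric] algebra_simps)
    finally show ?thesis .
  qed
  moreover have "0 < 1 + (\<Sum>b\<in>B. N b)"
    using NB by (simp add: add_pos_nonneg sum_nonneg)
  ultimately show ?thesis by blast
qed

lemma continuous_on_N: "continuous_on V N"
proof -
  obtain C where C: "C > 0" "\<And>x. x \<in> V \<Longrightarrow> N x \<le> C * norm x"
    using N_le_norm by blast
  have "\<bar>N x - N y\<bar> \<le> C * dist x y" if "x \<in> V" "y \<in> V" for x y
  proof -
    have d: "x - y \<in> V" "y - x \<in> V"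
      using that subspace by (auto intro: subspace_diff)
    have "N x \<le> N (x - y) + N y" "N y \<le> N (y - x) + N x"
      using N_triangle[OF d(1) that(2)] N_triangle[OF d(2) that(1)] by auto
    with C(2)[OF d(1)] N_minus_commute[OF that] show ?thesis
      by (auto simp: dist_norm)
  qed
  then have "C-lipschitz_on V N"
    using C(1) by (intro lipschitz_onI) (auto simp: dist_real_def)
  then show ?thesis
    by (rule lipschitz_on_continuous_on)
qed

text \<open>By compactness \<open>N\<close> has a positive minimum on the Euclidean unit sphere of
  \<open>V\<close>, and homogeneity does the rest. The sphere is empty if \<open>V = {0}\<close>,
  which happens for a block index that \<open>c\<close> does not hit.\<close>

lemma norm_le_N: "\<exists>C>0. \<forall>x\<in>V. norm x \<le> C * N x"
proof (cases "sphere 0 1 \<inter> V = {}")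
  case True
  have "x = 0" if "x \<in> V" for x
  proof (rule ccontr)
    assume "x \<noteq> 0"
    then have "(1 / norm x) *\<^sub>R x \<in> sphere 0 1 \<inter> V"
      using that subspace by (auto simp: subspace_scale)
    with True show False by blast
  qed
  then have "\<forall>x\<in>V. norm x \<le> 1 * N x"
    using N_zero by fastforce
  then show ?thesis
    using zero_less_one by blast
next
  case False
  have cpt: "compact (sphere 0 1 \<inter> V)"
    by (intro compact_Int_closed compact_sphere closed_subspace subspace)
  obtain y where y: "y \<in> sphere 0 1 \<inter> V" "\<And>x. x \<in> sphere 0 1 \<inter> V \<Longrightarrow> N y \<le> N x"
    using continuous_attains_inf[OF cpt False continuous_on_subset[OF continuous_on_N]] by auto
  have pos: "N y > 0"
    using y(1) N_nonneg[of y] N_eq_0_iff[of y] by force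
  have "norm x \<le> (1 / N y) * N x" if "x \<in> V" for x
  proof (cases "x = 0")
    case False
    have "N y \<le> N ((1 / norm x) *\<^sub>R x)"
      using False that subspace by (intro y(2)) (auto simp: subspace_scale)
    also have "\<dots> = N x / norm x"
      using N_scaleR[OF that, of "1 / norm x"] by simp
    finally show ?thesis
      using False pos by (simp add: field_simps)
  qed simp
  with pos show ?thesis by (intro exI[of _ "1 / N y"]) auto
qed

lemma unit_ball_bounded: "\<exists>C>0. \<forall>v\<in>V. N v \<le> 1 \<longrightarrow> norm v \<le> C"
proof -
  obtain C where C: "C > 0" "\<And>x. x \<in> V \<Longrightarrow> norm x \<le> C * N x"
    using norm_le_N by blast
  have "norm v \<le> C" if "v \<in> V" "N v \<le> 1" for v
    using C(2)[OF that(1)] mult_left_le[OF that(2), of C] C(1) by linarith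
  with C(1) show ?thesis by blast
qed

text \<open>A real \<open>Sup\<close> says something only for a nonempty set that is bounded above,
  so every use of the dual norm rests on this.\<close>

lemma bdd_above_dual: "bdd_above {u \<bullet> v |v. v \<in> V \<and> N v \<le> 1}"
proof -
  obtain C where C: "C > 0" "\<And>v. v \<in> V \<Longrightarrow> N v \<le> 1 \<Longrightarrow> norm v \<le> C"
    using unit_ball_bounded by blast
  have "u \<bullet> v \<le> norm u * C" if "v \<in> V" "N v \<le> 1" for v
    using C(2)[OF that] by (meson norm_cauchy_schwarz mult_left_mono norm_ge_zero order_trans)
  then show ?thesis
    unfolding bdd_above_def by blast
qed

lemma inner_le_dual_unit: "v \<in> V \<Longrightarrow> N v \<le> 1 \<Longrightarrow> u \<bullet> v \<le> dual u"
  unfolding dual_norm_on_def by (rule cSup_upper[OF _ bdd_above_dual]) auto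

lemma dual_leI: "(\<And>v. v \<in> V \<Longrightarrow> N v \<le> 1 \<Longrightarrow> u \<bullet> v \<le> K) \<Longrightarrow> dual u \<le> K"
  unfolding dual_norm_on_def using subspace_0[OF subspace] by (intro cSup_least) auto

lemma dual_nonneg: "0 \<le> dual u"
  using inner_le_dual_unit[of 0 u] subspace_0[OF subspace] by simp

lemma inner_le_dual:
  assumes "v \<in> V"
  shows "u \<bullet> v \<le> dual u * N v"
proof (cases "v = 0")
  case False
  then have pos: "N v > 0"
    using N_nonneg[OF assms] N_eq_0_iff[OF assms] by linarith
  have "u \<bullet> ((1 / N v) *\<^sub>R v) \<le> dual u"
    using assms pos subspace by (intro inner_le_dual_unit) (auto simp: subspace_scale N_scaleR)
  then show ?thesis
    using pos by (simp add: field_simps)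
qed simp

lemma dual_triangle: "dual (u + v) \<le> dual u + dual v"
  by (rule dual_leI) (auto simp: inner_add_left intro!: add_mono inner_le_dual_unit)

lemma dual_scaleR: "0 < a \<Longrightarrow> dual (a *\<^sub>R u) = a * dual u"
proof (rule antisym)
  show le: "dual (a *\<^sub>R u) \<le> a * dual u" if "0 < a" for a u
    using that by (intro dual_leI) (auto intro!: inner_le_dual_unit)
  assume "0 < a"
  with le[of "1 / a" "a *\<^sub>R u"] show "a * dual u \<le> dual (a *\<^sub>R u)"
    by (simp add: field_simps)
qed

lemma dual_le_norm: "\<exists>C>0. \<forall>u. dual u \<le> C * norm u"
proof -
  obtain C where C: "C > 0" "\<And>v. v \<in> V \<Longrightarrow> N v \<le> 1 \<Longrightarrow> norm v \<le> C"
    using unit_ball_bounded by blast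
  have "dual u \<le> C * norm u" for u
  proof (rule dual_leI)
    fix v assume v: "v \<in> V" "N v \<le> 1"
    show "u \<bullet> v \<le> C * norm u"
      using C(2)[OF v] by (metis norm_cauchy_schwarz mult.commute mult_left_mono norm_ge_zero order_trans)
  qed
  with C(1) show ?thesis by blast
qed

text \<open>Test \<open>u\<close> against itself. The restriction to \<open>u \<in> V\<close> is
  essential: the dual norm sees only the component of \<open>u\<close> in \<open>V\<close> and
  vanishes on its orthogonal complement.\<close>

lemma norm_le_dual: "\<exists>C>0. \<forall>u\<in>V. norm u \<le> C * dual u"
proof -
  obtain C where C: "C > 0" "\<And>x. x \<in> V \<Longrightarrow> N x \<le> C * norm x"
    using N_le_norm by blast
  have "norm u \<le> C * dual u" if "u \<in> V" for u
  proof (cases "u = 0")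
    case False
    have "norm u * norm u \<le> dual u * N u"
      using inner_le_dual[OF that, of u] by (simp add: dot_square_norm power2_eq_square)
    also have "\<dots> \<le> dual u * (C * norm u)"
      using C(2)[OF that] dual_nonneg by (intro mult_left_mono)
    also have "\<dots> = (C * dual u) * norm u"
      by (simp add: algebra_simps)
    finally show ?thesis
      by (rule mult_right_le_imp_le) (simp add: False)
  qed (simp add: C dual_nonneg less_imp_le)
  with C(1) show ?thesis by blast
qed

lemma continuous_on_dual: "continuous_on UNIV dual"
proof -
  obtain C where C: "C > 0" "\<And>u. dual u \<le> C * norm u"
    using dual_le_norm by blast
  have "\<bar>dual u - dual v\<bar> \<le> C * dist u v" for u v
    using dual_triangle[of "u - v" v] dual_triangle[of "v - u" u] C(2)[of "u - v"] C(2)[of "v - u"]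
    by (auto simp: dist_norm norm_minus_commute)
  then have "C-lipschitz_on UNIV dual"
    using C(1) by (intro lipschitz_onI) (auto simp: dist_real_def)
  then show ?thesis
    by (rule lipschitz_on_continuous_on)
qed

text \<open>The unit ball of \<open>N\<close> in \<open>V\<close> is compact. Actual maximizers are
  wanted because one per block will be assembled into a single test vector.\<close>

lemma dual_attained: "\<exists>v\<in>V. N v \<le> 1 \<and> u \<bullet> v = dual u"
proof -
  obtain C where C: "C > 0" "\<And>v. v \<in> V \<Longrightarrow> N v \<le> 1 \<Longrightarrow> norm v \<le> C"
    using unit_ball_bounded by blast
  have "closed (V \<inter> N -` {..1})"
    by (intro continuous_closed_preimage continuous_on_N closed_subspace subspace closed_atMost)
  moreover have "bounded (V \<inter> N -` {..1})"
    using C(2) by (auto simp: bounded_iff)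
  ultimately have "compact (V \<inter> N -` {..1})"
    by (simp add: compact_eq_bounded_closed)
  moreover have "0 \<in> V \<inter> N -` {..1}"
    using subspace_0[OF subspace] by simp
  ultimately obtain v where v: "v \<in> V \<inter> N -` {..1}" "\<And>v'. v' \<in> V \<inter> N -` {..1} \<Longrightarrow> u \<bullet> v' \<le> u \<bullet> v"
    using continuous_attains_sup[of "V \<inter> N -` {..1}" "\<lambda>v. u \<bullet> v"]
      continuous_on_inner[OF continuous_on_const continuous_on_id] by blast
  have "u \<bullet> v = dual u"
    using v by (intro antisym inner_le_dual_unit dual_leI) auto
  with v(1) show ?thesis by auto
qed

text \<open>Completing the square after \<open>inner_le_dual\<close>. The parameter \<open>m\<close>
  will be the strong convexity modulus, so that the last term is covered by a Bregman
  divergence.\<close>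

lemma young:
  assumes "v \<in> V" "0 < m"
  shows "u \<bullet> v \<le> (dual u)\<^sup>2 / (2 * m) + m / 2 * (N v)\<^sup>2"
proof -
  have "0 \<le> (dual u - m * N v)\<^sup>2 / (2 * m)"
    using assms(2) by simp
  also have "\<dots> = (dual u)\<^sup>2 / (2 * m) + m / 2 * (N v)\<^sup>2 - dual u * N v"
    using assms(2) by (simp add: field_simps power2_eq_square)
  finally show ?thesis
    using inner_le_dual[OF assms(1), of u] by linarith
qed

end

section \<open>Blocks\<close>

lemma block_nth [simp]: "block c i x $ j = (if c j = i then x $ j else 0)"
  by (simp add: block_def)

lemma linear_block: "linear (block c i)"
  by (rule linearI) (auto simp: vec_eq_iff)

lemma block_diff: "block c i (x - y) = block c i x - block c i y"
  by (rule linear_diff[OF linear_block])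

lemma block_add: "block c i (x + y) = block c i x + block c i y"
  by (rule linear_add[OF linear_block])

lemma block_scaleR: "block c i (a *\<^sub>R x) = a *\<^sub>R block c i x"
  by (rule linear_scale[OF linear_block])

lemma continuous_on_block: "continuous_on A (block c i)"
  by (intro linear_continuous_on linear_conv_bounded_linear[THEN iffD1] linear_block)

lemma borel_measurable_block [measurable]: "block c i \<in> borel_measurable borel"
  by (rule borel_measurable_continuous_onI[OF continuous_on_block])

lemma block_in_space [simp]: "block c i x \<in> block_space c i"
  by (simp add: block_space_def)

lemma subspace_block_space: "subspace (block_space c i)"
  by (auto simp: subspace_def block_space_def)

lemma block_of_block_space: "x \<in> block_space c i \<Longrightarrow> block c k x = (if k = i then x else 0)"
  by (auto simp: vec_eq_iff block_space_def)

lemma sum_block: "(\<Sum>i\<in>(UNIV :: 'l::finite set). block c i x) = x"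
  by (simp add: vec_eq_iff)

lemma inner_eq_sum_block:
  fixes c :: "'n::finite \<Rightarrow> 'l::finite"
  shows "x \<bullet> y = (\<Sum>i\<in>UNIV. block c i x \<bullet> block c i y)"
proof -
  have "(\<Sum>i\<in>UNIV. block c i x \<bullet> block c i y)
      = (\<Sum>i\<in>UNIV. \<Sum>j\<in>UNIV. if i = c j then x $ j * y $ j else 0)"
    by (auto simp: inner_vec_def intro!: sum.cong)
  also have "\<dots> = x \<bullet> y"
    by (subst sum.swap) (simp add: inner_vec_def)
  finally show ?thesis ..
qed

lemma inner_block_space:
  assumes "v \<in> block_space c i"
  shows "u \<bullet> v = block c i u \<bullet> v"
proof -
  have "x * v $ j = (if c j = i then x else 0) * v $ j" for x j
    using assms by (auto simp: block_space_def)
  then show ?thesis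
    by (auto simp: inner_vec_def intro!: sum.cong)
qed

lemma block_update:
  assumes "q \<in> block_space c i"
  shows "block c k (\<chi> j. if c j = i then q $ j else b $ j) = (if k = i then q else block c k b)"
  using assms by (auto simp: vec_eq_iff block_space_def)

section \<open>The product norm and its dual\<close>

locale normed_blocks =
  fixes c :: "'n::finite \<Rightarrow> 'l::finite" and N :: "'l \<Rightarrow> real ^ 'n \<Rightarrow> real"
  assumes norms: "\<And>i. is_norm_on (block_space c i) (N i)"
begin

sublocale nb: normed_subspace "block_space c i" "N i" for i
  by unfold_locales (auto simp: subspace_block_space norms)

lemma block_norm_sq: "(block_norm c N x)\<^sup>2 = (\<Sum>i\<in>UNIV. (N i (block c i x))\<^sup>2)"
  by (simp add: block_norm_def sum_nonneg)

lemma block_norm_L2: "block_norm c N x = L2_set (\<lambda>i. N i (block c i x)) UNIV"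
  by (simp add: block_norm_def L2_set_def)

lemma is_norm_on_block_norm: "is_norm_on UNIV (block_norm c N)"
  unfolding is_norm_on_def
proof (intro conjI ballI allI)
  fix x y :: "real ^ 'n" and a :: real
  show "0 \<le> block_norm c N x"
    by (simp add: block_norm_L2)
  show "block_norm c N x = 0 \<longleftrightarrow> x = 0"
  proof
    assume "block_norm c N x = 0"
    then have "N i (block c i x) = 0" for i
      by (simp add: block_norm_L2 L2_set_eq_0_iff)
    then have "block c i x = 0" for i
      by (simp add: nb.N_eq_0_iff)
    then show "x = 0"
      using sum_block[of c x] by simp
  next
    assume "x = 0"
    moreover have "block c i 0 = 0" for i
      by (simp add: vec_eq_iff)
    ultimately show "block_norm c N x = 0"
      by (simp add: block_norm_def)
  qed
  show "block_norm c N (a *\<^sub>R x) = \<bar>a\<bar> * block_norm c N x"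
    by (simp add: block_norm_L2 block_scaleR nb.N_scaleR L2_set_right_distrib)
  have "block_norm c N (x + y) \<le> L2_set (\<lambda>i. N i (block c i x) + N i (block c i y)) UNIV"
    unfolding block_norm_L2
    by (intro L2_set_mono)
      (auto simp: block_add subspace_block_space intro!: nb.N_triangle nb.N_nonneg subspace_add)
  also have "\<dots> \<le> block_norm c N x + block_norm c N y"
    unfolding block_norm_L2 by (rule L2_set_triangle_ineq)
  finally show "block_norm c N (x + y) \<le> block_norm c N x + block_norm c N y" .
qed

sublocale full: normed_subspace UNIV "block_norm c N"
  by unfold_locales (auto simp: is_norm_on_block_norm)

text \<open>Testing \<open>u\<close> against the combination of the blockwise maximizers weighted by their dual norms
  gives the estimate.\<close>

lemma sum_dual_block_sq_le: "(\<Sum>i\<in>UNIV. (nb.dual i (block c i u))\<^sup>2) \<le> (full.dual u)\<^sup>2"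
proof -
  define a where "a i = nb.dual i (block c i u)" for i
  obtain v where v: "\<And>i. v i \<in> block_space c i" "\<And>i. N i (v i) \<le> 1"
    "\<And>i. block c i u \<bullet> v i = a i"
  proof -
    have "\<forall>i. \<exists>v. v \<in> block_space c i \<and> N i v \<le> 1 \<and> block c i u \<bullet> v = a i"
      unfolding a_def using nb.dual_attained by blast
    then show ?thesis
      using that by metis
  qed
  define s where "s = sqrt (\<Sum>i\<in>UNIV. (a i)\<^sup>2)"
  have s2: "s\<^sup>2 = (\<Sum>i\<in>UNIV. (a i)\<^sup>2)" and s0: "0 \<le> s"
    by (auto simp: s_def sum_nonneg)
  define x where "x = (\<Sum>i\<in>UNIV. a i *\<^sub>R v i)"
  have a0: "0 \<le> a i" for i
    by (simp add: a_def nb.dual_nonneg)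
  have bx: "block c i x = a i *\<^sub>R v i" for i
  proof -
    have "block c i x = (\<Sum>k\<in>UNIV. a k *\<^sub>R (if i = k then v k else 0))"
      by (simp add: x_def linear_sum[OF linear_block] block_scaleR block_of_block_space[OF v(1)])
    also have "\<dots> = (\<Sum>k\<in>UNIV. if i = k then a k *\<^sub>R v k else 0)"
      by (rule sum.cong) auto
    finally show ?thesis by simp
  qed
  have "block_norm c N x \<le> s"
    unfolding block_norm_def s_def
  proof (intro real_sqrt_le_mono sum_mono power_mono)
    fix i
    show "N i (block c i x) \<le> a i"
      using mult_left_mono[OF v(2)[of i] a0[of i]] by (simp add: bx nb.N_scaleR[OF v(1)] a0)
  qed (simp add: nb.N_nonneg)
  have "s\<^sup>2 = u \<bullet> x"
    unfolding s2 inner_eq_sum_block[of u x c] by (simp add: bx v(3) power2_eq_square)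
  also have "\<dots> \<le> full.dual u * block_norm c N x"
    by (rule full.inner_le_dual) simp
  also have "\<dots> \<le> full.dual u * s"
    using \<open>block_norm c N x \<le> s\<close> full.dual_nonneg by (rule mult_left_mono)
  finally have "s * s \<le> full.dual u * s"
    by (simp add: power2_eq_square)
  \<comment> \<open>Cancelling the factor \<open>s\<close> is possible only if \<open>s\<close> is
    nonzero; for \<open>s = 0\<close> the claim is nonnegativity of the dual norm.\<close>
  then have "s \<le> full.dual u" if "s \<noteq> 0"
    by (rule mult_right_le_imp_le) (use s0 that in simp)
  then have "s \<le> full.dual u"
    using full.dual_nonneg[of u] by (cases "s = 0") simp_all
  then show ?thesis
    using s0 unfolding a_def[symmetric] s2[symmetric] by (rule power_mono)
qed

end

section \<open>The prox mapping\<close>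

text \<open>Along the segment from \<open>q\<close> to \<open>y\<close> a negative one-sided
  derivative at \<open>q\<close> would produce feasible points of smaller value. The lemma serves
  both the prox objective and \<open>F\<close> at its constrained minimizer.\<close>

lemma arg_min_variational:
  fixes \<phi> :: "'a::real_normed_vector \<Rightarrow> real"
  assumes "convex S" and min: "is_arg_min \<phi> (\<lambda>x. x \<in> S) q"
    and deriv: "(\<phi> has_derivative \<phi>') (at q within S)" and "y \<in> S"
  shows "0 \<le> \<phi>' (y - q)"
proof (rule ccontr)
  assume neg: "\<not> 0 \<le> \<phi>' (y - q)"
  have q: "q \<in> S" and le: "\<And>x. x \<in> S \<Longrightarrow> \<phi> q \<le> \<phi> x"
    using min by (auto simp: is_arg_min_def not_less)
  define \<gamma> where "\<gamma> h = q + h *\<^sub>R (y - q)" for h :: real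
  have \<gamma>S: "\<gamma> ` {0..1} \<subseteq> S"
  proof safe
    fix h :: real assume "h \<in> {0..1}"
    then have "(1 - h) *\<^sub>R q + h *\<^sub>R y \<in> S"
      using convexD_alt[OF assms(1) q assms(4)] by auto
    then show "\<gamma> h \<in> S"
      by (simp add: \<gamma>_def algebra_simps)
  qed
  have "(\<gamma> has_derivative (\<lambda>h. h *\<^sub>R (y - q))) (at 0 within {0..1})"
    unfolding \<gamma>_def by (auto intro!: derivative_eq_intros)
  moreover have "(\<phi> has_derivative \<phi>') (at (\<gamma> 0) within \<gamma> ` {0..1})"
    using has_derivative_subset[OF deriv \<gamma>S] by (simp add: \<gamma>_def)
  ultimately have "(\<phi> \<circ> \<gamma> has_derivative \<phi>' \<circ> (\<lambda>h. h *\<^sub>R (y - q))) (at 0 within {0..1})"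
    by (rule diff_chain_within)
  moreover have "\<phi>' \<circ> (\<lambda>h. h *\<^sub>R (y - q)) = (*) (\<phi>' (y - q))"
    using linear_scale[OF has_derivative_linear[OF deriv]] by (auto simp: fun_eq_iff)
  ultimately have "((\<phi> \<circ> \<gamma>) has_real_derivative \<phi>' (y - q)) (at 0 within {0..1})"
    by (simp add: has_field_derivative_def)
  then obtain d where d: "d > 0"
    "\<And>h. 0 < h \<Longrightarrow> h \<in> {0..1} \<Longrightarrow> h < d \<Longrightarrow> \<phi> (\<gamma> h) < \<phi> (\<gamma> 0)"
    using neg has_real_derivative_neg_dec_right[of "\<phi> \<circ> \<gamma>" "\<phi>' (y - q)" 0 "{0..1}"] by auto
  define h where "h = min 1 (d / 2)"
  have h: "0 < h" "h \<in> {0..1}" "h < d"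
    using d(1) by (auto simp: h_def)
  have "\<phi> q \<le> \<phi> (\<gamma> h)"
    using \<gamma>S h(2) by (intro le) blast
  then show False
    using d(2)[OF h] by (simp add: \<gamma>_def)
qed

lemma bregman_swap_add:
  "bregman w dw x y + bregman w dw y x = (dw x - dw y) \<bullet> (x - y)"
  by (simp add: bregman_def algebra_simps)

text \<open>An algebraic identity that expresses the change of divergence by a gradient difference
  tested on \<open>y - q\<close>, the quantity controlled by the variational inequality of the prox
  point.\<close>

lemma bregman_three_point:
  "bregman w dw q y = bregman w dw x y - bregman w dw x q + (dw x - dw q) \<bullet> (y - q)"
  by (simp add: bregman_def algebra_simps)

locale mirror_map = normed_subspace V N
  for V :: "'a::euclidean_space set" and N +
  fixes S :: "'a set" and w :: "'a \<Rightarrow> real" and dw :: "'a \<Rightarrow> 'a" and m :: real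
  assumes S_subset: "S \<subseteq> V" and S_closed: "closed S" and S_convex: "convex S"
    and dw_grad: "\<And>x. x \<in> V \<Longrightarrow> (w has_derivative (\<lambda>h. dw x \<bullet> h)) (at x within V)"
    and dw_cont: "continuous_on V dw"
    and m_pos: "0 < m"
    and w_strong: "\<And>x y. x \<in> S \<Longrightarrow> y \<in> S \<Longrightarrow> m / 2 * (N (y - x))\<^sup>2 \<le> bregman w dw x y"
begin

lemma diff_in_V: "x \<in> S \<Longrightarrow> y \<in> S \<Longrightarrow> x - y \<in> V"
  by (rule subspace_diff[OF subspace]) (use S_subset in blast)+

lemma bregman_nonneg:
  assumes "x \<in> S" "y \<in> S"
  shows "0 \<le> bregman w dw x y"
proof -
  have "0 \<le> m / 2 * (N (y - x))\<^sup>2"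
    using m_pos by simp
  also have "\<dots> \<le> bregman w dw x y"
    by (rule w_strong[OF assms])
  finally show ?thesis .
qed

lemma continuous_on_w: "continuous_on S w"
  by (rule continuous_on_subset[OF has_derivative_continuous_on[OF dw_grad] S_subset])

lemma has_derivative_prox_objective:
  assumes "q \<in> S"
  shows "((\<lambda>z. v \<bullet> z + bregman w dw x z) has_derivative (\<lambda>h. (v + dw q - dw x) \<bullet> h)) (at q within S)"
proof -
  have "(w has_derivative (\<lambda>h. dw q \<bullet> h)) (at q within S)"
    by (rule has_derivative_subset[OF dw_grad S_subset]) (use S_subset assms in blast)
  then show ?thesis
    unfolding bregman_def by (auto intro!: derivative_eq_intros simp: algebra_simps)
qed

text \<open>\<open>prox\<close> is defined by a choice operator and means nothing until a minimizer
  exists. Strong convexity makes the divergence outgrow the linear term, so the search reduces to a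
  compact ball around \<open>x\<close>.\<close>

lemma prox_objective_attained:
  assumes x: "x \<in> S"
  shows "\<exists>q. is_arg_min (\<lambda>z. v \<bullet> z + bregman w dw x z) (\<lambda>z. z \<in> S) q"
proof -
  define \<phi> where "\<phi> z = v \<bullet> z + bregman w dw x z" for z
  obtain C where C: "C > 0" "\<And>u. u \<in> V \<Longrightarrow> norm u \<le> C * N u"
    using norm_le_N by blast
  \<comment> \<open>Beyond distance \<open>R\<close>, the bound
    \<open>m / (2 * C\<^sup>2) * (norm (z - x))\<^sup>2\<close> from below for the divergence is at
    least \<open>norm v * norm (z - x)\<close>, the most that the linear term can gain.\<close>
  define R where "R = 2 * C\<^sup>2 * norm v / m"
  have far: "\<phi> x \<le> \<phi> z" if z: "z \<in> S" and far: "R < norm (z - x)" for z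
  proof -
    have V: "z - x \<in> V"
      using diff_in_V z x by blast
    have "(norm (z - x))\<^sup>2 \<le> C\<^sup>2 * (N (z - x))\<^sup>2"
      using power_mono[OF C(2)[OF V], of 2] by (simp add: power_mult_distrib)
    then have "m * (norm (z - x))\<^sup>2 \<le> m * (C\<^sup>2 * (N (z - x))\<^sup>2)"
      using m_pos by simp
    also have "\<dots> = 2 * C\<^sup>2 * (m / 2 * (N (z - x))\<^sup>2)"
      by simp
    also have "\<dots> \<le> 2 * C\<^sup>2 * bregman w dw x z"
      using w_strong[OF x z] by (intro mult_left_mono) auto
    finally have 1: "m * (norm (z - x))\<^sup>2 \<le> 2 * C\<^sup>2 * bregman w dw x z" .
    have "2 * C\<^sup>2 * norm v \<le> m * norm (z - x)"
      using far m_pos by (simp add: R_def field_simps)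
    then have "2 * C\<^sup>2 * norm v * norm (z - x) \<le> m * norm (z - x) * norm (z - x)"
      by (rule mult_right_mono) simp
    with 1 have "2 * C\<^sup>2 * (norm v * norm (z - x)) \<le> 2 * C\<^sup>2 * bregman w dw x z"
      by (simp add: power2_eq_square algebra_simps)
    then have "norm v * norm (z - x) \<le> bregman w dw x z"
      using C(1) by simp
    moreover have "v \<bullet> (x - z) \<le> norm v * norm (z - x)"
      using norm_cauchy_schwarz[of v "x - z"] by (simp add: norm_minus_commute)
    moreover have "bregman w dw x x = 0"
      by (simp add: bregman_def)
    ultimately show ?thesis
      by (simp add: \<phi>_def inner_diff_right)
  qed
  have "compact (S \<inter> cball x R)"
    using S_closed by (simp add: closed_Int_compact)
  moreover have "x \<in> S \<inter> cball x R"
    using x m_pos by (simp add: R_def)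
  moreover have "continuous_on S \<phi>"
    unfolding \<phi>_def bregman_def by (intro continuous_intros continuous_on_w)
  then have "continuous_on (S \<inter> cball x R) \<phi>"
    by (rule continuous_on_subset) simp
  ultimately obtain q where q: "q \<in> S \<inter> cball x R" "\<And>z. z \<in> S \<inter> cball x R \<Longrightarrow> \<phi> q \<le> \<phi> z"
    using continuous_attains_inf[of "S \<inter> cball x R" \<phi>] by blast
  have "\<phi> q \<le> \<phi> z" if "z \<in> S" for z
  proof (cases "R < norm (z - x)")
    case True
    then show ?thesis
      using q(2)[OF \<open>x \<in> S \<inter> cball x R\<close>] far[OF that] by linarith
  next
    case False
    then show ?thesis
      using that by (intro q(2)) (simp add: dist_norm norm_minus_commute)
  qed
  then have "is_arg_min \<phi> (\<lambda>z. z \<in> S) q"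
    using q(1) by (auto simp: is_arg_min_def not_less)
  then show ?thesis
    unfolding \<phi>_def by blast
qed

lemma is_arg_min_prox:
  "x \<in> S \<Longrightarrow> is_arg_min (\<lambda>z. v \<bullet> z + bregman w dw x z) (\<lambda>z. z \<in> S) (prox S w dw x v)"
  unfolding prox_def arg_min_on_def arg_min_def by (rule someI_ex[OF prox_objective_attained])

lemma prox_in: "x \<in> S \<Longrightarrow> prox S w dw x v \<in> S"
  using is_arg_min_prox by (simp add: is_arg_min_def)

lemma prox_variational:
  assumes "x \<in> S" "y \<in> S"
  shows "0 \<le> (v + dw (prox S w dw x v) - dw x) \<bullet> (y - prox S w dw x v)"
  using arg_min_variational[OF S_convex is_arg_min_prox[OF assms(1)]
      has_derivative_prox_objective[OF prox_in[OF assms(1)]] assms(2)] .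

text \<open>Test each of the two variational inequalities with the other prox point and add them;
  strong convexity bounds the symmetrized divergence below by
  \<open>m * (N (q - q'))\<^sup>2\<close>. Up to a constant the objective is
  \<open>w z - (dw x - v) \<bullet> z\<close>, hence the dependence on \<open>dw x - v\<close>
  alone.\<close>

lemma prox_lipschitz:
  "\<exists>C>0. \<forall>x\<in>S. \<forall>x'\<in>S. \<forall>v v'.
     dist (prox S w dw x v) (prox S w dw x' v') \<le> C * dist (dw x - v) (dw x' - v')"
proof -
  obtain C where C: "C > 0" "\<And>u. u \<in> V \<Longrightarrow> norm u \<le> C * N u"
    using norm_le_N by blast
  have "dist q q' \<le> C\<^sup>2 / m * dist (dw x - v) (dw x' - v')"
    if x: "x \<in> S" "x' \<in> S" and q: "q = prox S w dw x v" "q' = prox S w dw x' v'" for x x' v v' q q'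
  proof (cases "q = q'")
    case False
    have qS: "q \<in> S" "q' \<in> S"
      using x q by (auto intro: prox_in)
    define e where "e = (dw x - v) - (dw x' - v')"
    have V: "q - q' \<in> V"
      using diff_in_V qS by blast
    have "(norm (q - q'))\<^sup>2 \<le> C\<^sup>2 * (N (q - q'))\<^sup>2"
      using power_mono[OF C(2)[OF V], of 2] by (simp add: power_mult_distrib)
    then have "m * (norm (q - q'))\<^sup>2 \<le> C\<^sup>2 * (m * (N (q - q'))\<^sup>2)"
      using m_pos by (simp add: mult.left_commute)
    also have "m * (N (q - q'))\<^sup>2 \<le> bregman w dw q q' + bregman w dw q' q"
      using w_strong[OF qS] w_strong[OF qS(2,1)] N_minus_commute[of q q'] qS S_subset
      by (simp add: subset_iff)
    also have "\<dots> \<le> e \<bullet> (q - q')"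
      using prox_variational[OF x(1) qS(2), of v] prox_variational[OF x(2) qS(1), of v']
      unfolding bregman_swap_add e_def q[symmetric] by (simp add: algebra_simps)
    also have "\<dots> \<le> norm e * norm (q - q')"
      by (rule norm_cauchy_schwarz)
    finally have "(m * norm (q - q')) * norm (q - q') \<le> (C\<^sup>2 * norm e) * norm (q - q')"
      using C(1) by (simp add: power2_eq_square algebra_simps)
    then have "m * norm (q - q') \<le> C\<^sup>2 * norm e"
      by (rule mult_right_le_imp_le) (simp add: False)
    then show ?thesis
      using m_pos by (simp add: dist_norm e_def field_simps)
  qed (use C(1) m_pos in simp)
  moreover have "C\<^sup>2 / m > 0"
    using C(1) m_pos by simp
  ultimately show ?thesis
    by (intro exI[of _ "C\<^sup>2 / m"]) simp
qed

text \<open>Since \<open>dw\<close> is merely continuous, \<open>prox_lipschitz\<close> yields no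
  Lipschitz bound in \<open>x\<close>; the distance of prox points is squeezed to 0 instead. Joint
  continuity is what makes the random iterates measurable.\<close>

lemma continuous_on_prox: "continuous_on (S \<times> UNIV) (\<lambda>(x, v). prox S w dw x v)"
proof -
  obtain C where C: "C > 0" "\<And>x x' v v'. x \<in> S \<Longrightarrow> x' \<in> S \<Longrightarrow>
     dist (prox S w dw x v) (prox S w dw x' v') \<le> C * dist (dw x - v) (dw x' - v')"
    using prox_lipschitz by blast
  have "continuous_on (S \<times> UNIV) (\<lambda>a. dw (fst a) - snd a)"
    by (intro continuous_intros continuous_on_compose2[OF dw_cont]) (use S_subset in auto)
  then have lim: "((\<lambda>a. C * dist (dw (fst a) - snd a) (dw (fst b) - snd b)) \<longlongrightarrow> C * 0) (at b within S \<times> UNIV)"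
    if "b \<in> S \<times> UNIV" for b
    using that unfolding continuous_on_def
    by (intro tendsto_mult tendsto_const tendsto_dist_iff[THEN iffD1]) blast
  show ?thesis
    unfolding continuous_on_def
  proof
    fix b :: "'a \<times> 'a" assume b: "b \<in> S \<times> UNIV"
    have "((\<lambda>a. dist (case a of (x, v) \<Rightarrow> prox S w dw x v) (case b of (x, v) \<Rightarrow> prox S w dw x v)) \<longlongrightarrow> 0)
        (at b within S \<times> UNIV)"
    proof (rule tendsto_sandwich[OF _ _ tendsto_const])
      show "((\<lambda>a. C * dist (dw (fst a) - snd a) (dw (fst b) - snd b)) \<longlongrightarrow> 0) (at b within S \<times> UNIV)"
        using lim[OF b] by simp
      show "\<forall>\<^sub>F a in at b within S \<times> UNIV. dist (case a of (x, v) \<Rightarrow> prox S w dw x v) (case b of (x, v) \<Rightarrow> prox S w dw x v)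
          \<le> C * dist (dw (fst a) - snd a) (dw (fst b) - snd b)"
        unfolding eventually_at_filter by (rule always_eventually) (use b C(2) in auto)
    qed simp
    then show "((\<lambda>(x, v). prox S w dw x v) \<longlongrightarrow> (case b of (x, v) \<Rightarrow> prox S w dw x v)) (at b within S \<times> UNIV)"
      by (rule tendsto_dist_iff[THEN iffD2])
  qed
qed

text \<open>The vector \<open>u\<close> stands for a gradient at a constrained minimizer \<open>y\<close>; it need not vanish.\<close>

lemma bregman_prox_le:
  assumes x: "x \<in> S" and y: "y \<in> S" and u: "\<And>s. s \<in> S \<Longrightarrow> 0 \<le> u \<bullet> (s - y)"
  shows "bregman w dw (prox S w dw x v) y
    \<le> bregman w dw x y + (v - u) \<bullet> (y - x) + (dual (v - u))\<^sup>2 / (2 * m)"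
proof -
  define q where "q = prox S w dw x v"
  have q: "q \<in> S"
    unfolding q_def by (rule prox_in[OF x])
  have "(dw x - dw q) \<bullet> (y - q) \<le> v \<bullet> (y - q)"
    using prox_variational[OF x y, of v] unfolding q_def[symmetric] by (simp add: algebra_simps)
  \<comment> \<open>The hypothesis on \<open>u\<close> at \<open>s = q\<close> gives
    \<open>u \<bullet> (y - q) \<le> 0\<close>; then \<open>y - q\<close> is split at
    \<open>x\<close>, because \<open>q\<close> still depends on the stochastic gradient while
    \<open>x\<close> does not.\<close>
  also have "\<dots> \<le> (v - u) \<bullet> (y - x) + (v - u) \<bullet> (x - q)"
    using u[OF q] by (simp add: algebra_simps)
  finally have "bregman w dw q y \<le> bregman w dw x y - bregman w dw x q
      + ((v - u) \<bullet> (y - x) + (v - u) \<bullet> (x - q))"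
    unfolding bregman_three_point[of w dw q y x] by linarith
  \<comment> \<open>Young's inequality with parameter \<open>m\<close> produces exactly the
    quadratic term that \<open>bregman w dw x q\<close> dominates, hence the constant
    \<open>1 / (2 * m)\<close>.\<close>
  moreover have "(v - u) \<bullet> (x - q) \<le> (dual (v - u))\<^sup>2 / (2 * m) + m / 2 * (N (x - q))\<^sup>2"
    by (intro young diff_in_V x q m_pos)
  moreover have "m / 2 * (N (x - q))\<^sup>2 \<le> bregman w dw x q"
    using w_strong[OF x q] N_minus_commute[of x q] x q S_subset by (simp add: subset_iff)
  ultimately show ?thesis
    unfolding q_def[symmetric] by linarith
qed

end

text \<open>Continuity is available only on the feasible set, so the composition passes through the
  Borel sets restricted to \<open>A\<close>; this is why \<open>b\<close> must stay in
  \<open>A\<close> at every point.\<close>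

lemma measurable_continuous_comp:
  assumes "b \<in> borel_measurable H" "\<And>\<omega>. b \<omega> \<in> A" "continuous_on A \<phi>"
  shows "(\<lambda>\<omega>. \<phi> (b \<omega>)) \<in> borel_measurable H"
  by (rule measurable_compose[OF measurable_restrict_space2 borel_measurable_continuous_on_restrict])
    (use assms in auto)

section \<open>One step of the block scheme\<close>

locale block_mirror = normed_blocks c N
  for c :: "'n::finite \<Rightarrow> 'l::finite" and N +
  fixes B :: "'l \<Rightarrow> (real ^ 'n) set" and w :: "'l \<Rightarrow> real ^ 'n \<Rightarrow> real"
    and dw :: "'l \<Rightarrow> real ^ 'n \<Rightarrow> real ^ 'n" and m p :: "'l \<Rightarrow> real"
  assumes B_subset: "\<And>i. B i \<subseteq> block_space c i" and B_closed: "\<And>i. closed (B i)"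
    and B_convex: "\<And>i. convex (B i)"
    and dw_grad: "\<And>i x. x \<in> block_space c i \<Longrightarrow>
      (w i has_derivative (\<lambda>h. dw i x \<bullet> h)) (at x within block_space c i)"
    and dw_cont: "\<And>i. continuous_on (block_space c i) (dw i)"
    and m_pos: "\<And>i. 0 < m i"
    and w_strong: "\<And>i x y. x \<in> B i \<Longrightarrow> y \<in> B i \<Longrightarrow>
      m i / 2 * (N i (y - x))\<^sup>2 \<le> bregman (w i) (dw i) x y"
    and p_pos: "\<And>i. 0 < p i"
begin

sublocale mm: mirror_map "block_space c i" "N i" "B i" "w i" "dw i" "m i" for i
  by unfold_locales (use B_subset B_closed B_convex dw_grad dw_cont m_pos w_strong in auto)

text \<open>One step of \<open>rbsmd\<close> with the block index and the scaled gradient block as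
  free arguments, so that estimates can be made for a fixed index before it becomes random.\<close>

definition update :: "'l \<Rightarrow> real ^ 'n \<Rightarrow> real ^ 'n \<Rightarrow> real ^ 'n" where
  "update i v b = (\<chi> j. if c j = i then prox (B i) (w i) (dw i) (block c i b) v $ j else b $ j)"

lemma block_in: "b \<in> block_prod c B \<Longrightarrow> block c i b \<in> B i"
  by (simp add: block_prod_def)

lemma block_update_eq:
  assumes "b \<in> block_prod c B"
  shows "block c k (update i v b) =
    (if k = i then prox (B i) (w i) (dw i) (block c i b) v else block c k b)"
  unfolding update_def using mm.prox_in[OF block_in[OF assms]] B_subset by (intro block_update) blast

lemma update_in: "b \<in> block_prod c B \<Longrightarrow> update i v b \<in> block_prod c B"
  using block_update_eq[of b _ i v] mm.prox_in[OF block_in] by (auto simp: block_prod_def)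

text \<open>A sum of maps in place of the coordinatewise case distinction, suited to measurability
  arguments.\<close>

lemma update_eq:
  assumes "b \<in> block_prod c B"
  shows "update i v b = b - block c i b + prox (B i) (w i) (dw i) (block c i b) v"
proof -
  have "prox (B i) (w i) (dw i) (block c i b) v \<in> block_space c i"
    using mm.prox_in[OF block_in[OF assms]] B_subset by blast
  then show ?thesis
    by (auto simp: update_def vec_eq_iff block_space_def)
qed

lemma error_fun_nonneg: "b \<in> block_prod c B \<Longrightarrow> y \<in> block_prod c B \<Longrightarrow> 0 \<le> error_fun c p w dw b y"
  unfolding error_fun_def
  by (intro sum_nonneg mult_nonneg_nonneg mm.bregman_nonneg block_in) (simp_all add: p_pos less_imp_le)

text \<open>Only the \<open>i\<close>th summand changes, so the prox inequality of that block enters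
  with its weight \<open>1 / p i\<close>, ready to cancel against the sampling probability.\<close>

lemma error_fun_update:
  assumes b: "b \<in> block_prod c B" and y: "y \<in> block_prod c B"
    and u: "\<And>s. s \<in> B i \<Longrightarrow> 0 \<le> block c i u \<bullet> (s - block c i y)"
  shows "error_fun c p w dw (update i (block c i v) b) y \<le> error_fun c p w dw b y
    + (block c i (v - u) \<bullet> block c i (y - b) + (nb.dual i (block c i (v - u)))\<^sup>2 / (2 * m i)) / p i"
proof -
  let ?D = "\<lambda>k x. bregman (w k) (dw k) x (block c k y)"
  define q where "q = prox (B i) (w i) (dw i) (block c i b) (block c i v)"
  have "error_fun c p w dw (update i (block c i v) b) y =
      (\<Sum>k\<in>UNIV. inverse (p k) * ?D k (block c k b)
        + (if k = i then inverse (p k) * (?D k q - ?D k (block c k b)) else 0))"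
    unfolding error_fun_def
    by (intro sum.cong) (auto simp: block_update_eq[OF b] q_def algebra_simps)
  also have "\<dots> = error_fun c p w dw b y + (?D i q - ?D i (block c i b)) / p i"
    by (simp add: sum.distrib error_fun_def field_simps)
  also have "?D i q - ?D i (block c i b)
      \<le> block c i (v - u) \<bullet> block c i (y - b) + (nb.dual i (block c i (v - u)))\<^sup>2 / (2 * m i)"
    using mm.bregman_prox_le[OF block_in[OF b] block_in[OF y] u, of "block c i v"]
    unfolding q_def block_diff by linarith
  finally show ?thesis
    using p_pos[of i] by (simp add: divide_right_mono)
qed

text \<open>Blockwise strong convexity; undoing the weight \<open>1 / p i\<close> costs at most
  \<open>Max (range p)\<close>. Besides bounding the quadratic term, it turns integrability of the
  error function into square integrability of distances.\<close>

lemma block_norm_sq_le_error_fun: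
  assumes b: "b \<in> block_prod c B" and y: "y \<in> block_prod c B"
  shows "(block_norm c N (b - y))\<^sup>2
    \<le> 2 * Max (range p) / Min (range m) * error_fun c p w dw b y"
proof -
  have "(N i (block c i (b - y)))\<^sup>2
      \<le> 2 * Max (range p) / Min (range m) * (inverse (p i) * bregman (w i) (dw i) (block c i b) (block c i y))" for i
  proof -
    let ?D = "bregman (w i) (dw i) (block c i b) (block c i y)"
    have p: "p i \<le> Max (range p)" and m: "Min (range m) \<le> m i" and m0: "0 < Min (range m)"
      using m_pos by (auto simp: Min_gr_iff)
    have D0: "0 \<le> ?D"
      using b y by (intro mm.bregman_nonneg block_in)
    have "m i / 2 * (N i (block c i (b - y)))\<^sup>2 \<le> ?D"
      using w_strong[OF block_in[OF b] block_in[OF y], of i]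
        nb.N_minus_commute[of "block c i b" i "block c i y"] by (simp add: block_diff)
    then have "(N i (block c i (b - y)))\<^sup>2 \<le> 2 * ?D / m i"
      using m_pos[of i] by (simp add: field_simps)
    also have "\<dots> \<le> 2 * ?D / Min (range m)"
      using m m0 m_pos[of i] D0 by (intro divide_left_mono) auto
    also have "\<dots> = 2 / Min (range m) * (inverse (p i) * ?D) * p i"
      using p_pos[of i] by (simp add: field_simps)
    also have "\<dots> \<le> 2 / Min (range m) * (inverse (p i) * ?D) * Max (range p)"
      by (rule mult_left_mono[OF p])
        (intro mult_nonneg_nonneg divide_nonneg_pos m0 D0, simp_all add: p_pos less_imp_le)
    finally show ?thesis
      by (simp add: field_simps)
  qed
  then show ?thesis
    unfolding block_norm_sq error_fun_def sum_distrib_left by (rule sum_mono)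
qed

text \<open>Nothing forces \<open>0 < Max (range Lw)\<close>: if it fails, every factor \<open>B i\<close> is a single point.\<close>

lemma error_fun_le_block_norm_sq:
  assumes b: "b \<in> block_prod c B" and y: "y \<in> block_prod c B"
    and smooth: "\<And>i x y. x \<in> B i \<Longrightarrow> y \<in> B i \<Longrightarrow>
      bregman (w i) (dw i) x y \<le> Lw i / 2 * (N i (y - x))\<^sup>2"
  shows "2 * Min (range p) / Max (range Lw) * error_fun c p w dw b y \<le> (block_norm c N (b - y))\<^sup>2"
proof -
  have "2 * Min (range p) / Max (range Lw) * (inverse (p i) * bregman (w i) (dw i) (block c i b) (block c i y))
      \<le> (N i (block c i (b - y)))\<^sup>2" for i
  proof -
    let ?D = "bregman (w i) (dw i) (block c i b) (block c i y)"
    have p: "Min (range p) \<le> p i" and L: "Lw i \<le> Max (range Lw)"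
      by auto
    have p0: "0 < Min (range p)"
      using p_pos by (auto simp: Min_gr_iff)
    have D0: "0 \<le> ?D"
      using b y by (intro mm.bregman_nonneg block_in)
    have "?D \<le> Lw i / 2 * (N i (block c i (b - y)))\<^sup>2"
      using smooth[OF block_in[OF b] block_in[OF y], of i]
        nb.N_minus_commute[of "block c i b" i "block c i y"] by (simp add: block_diff)
    also have "\<dots> \<le> Max (range Lw) / 2 * (N i (block c i (b - y)))\<^sup>2"
      using L by (intro mult_right_mono) auto
    finally have D: "?D \<le> Max (range Lw) / 2 * (N i (block c i (b - y)))\<^sup>2" .
    \<comment> \<open>Regrouped into a factor at most 1 and a factor that smoothness bounds. If
      \<open>Max (range Lw)\<close> is not positive, the second factor is at most 0, division by
      zero included.\<close>
    have "2 * Min (range p) / Max (range Lw) * (inverse (p i) * ?D) = Min (range p) / p i * (2 * ?D / Max (range Lw))"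
      by (simp add: field_simps)
    also have "\<dots> \<le> (N i (block c i (b - y)))\<^sup>2"
    proof (cases "0 < Max (range Lw)")
      case True
      have "Min (range p) / p i * (2 * ?D / Max (range Lw)) \<le> 1 * (2 * ?D / Max (range Lw))"
        using p p_pos[of i] D0 True by (intro mult_right_mono) (auto simp: field_simps)
      also have "\<dots> \<le> (N i (block c i (b - y)))\<^sup>2"
        using D True by (simp add: field_simps)
      finally show ?thesis .
    next
      case False
      then have "Min (range p) / p i * (2 * ?D / Max (range Lw)) \<le> 0"
        using D0 by (intro mult_nonneg_nonpos divide_nonneg_nonpos
            divide_nonneg_pos[OF less_imp_le[OF p0] p_pos]) linarith+
      then show ?thesis
        by (rule order_trans) simp
    qed
    finally show ?thesis .
  qed
  then show ?thesis
    unfolding block_norm_sq error_fun_def sum_distrib_left by (rule sum_mono)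
qed

text \<open>The deterministic half of the estimate: \<open>h\<close> stands for the gradient
  difference between \<open>b\<close> and \<open>y\<close>, and \<open>\<nu> i\<close> for a noise
  level that is already squared. \<open>Min (range m)\<close> gets squared because it arises once
  from the weights \<open>1 / m i\<close> and once from
  \<open>block_norm_sq_le_error_fun\<close>.\<close>

lemma contraction:
  assumes b: "b \<in> block_prod c B" and y: "y \<in> block_prod c B"
    and smooth: "\<And>i x y. x \<in> B i \<Longrightarrow> y \<in> B i \<Longrightarrow>
      bregman (w i) (dw i) x y \<le> Lw i / 2 * (N i (y - x))\<^sup>2"
    and mono: "\<mu>F * (block_norm c N (b - y))\<^sup>2 \<le> h \<bullet> (b - y)"
    and lip: "full.dual h \<le> LF * block_norm c N (b - y)"
    and pos: "0 < \<mu>F" "0 < e"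
  shows "error_fun c p w dw b y + (\<Sum>i\<in>UNIV. e * (block c i h \<bullet> block c i (y - b))
      + e\<^sup>2 / m i * (\<nu> i + (nb.dual i (block c i h))\<^sup>2))
    \<le> (1 - e * (2 * \<mu>F * Min (range p) / Max (range Lw))
        + e\<^sup>2 * (2 * LF\<^sup>2 * Max (range p) / (Min (range m))\<^sup>2)) * error_fun c p w dw b y
      + e\<^sup>2 * (\<Sum>i\<in>UNIV. \<nu> i / m i)"
proof -
  let ?E = "error_fun c p w dw b y" and ?n2 = "(block_norm c N (b - y))\<^sup>2"
  have m0: "0 < Min (range m)"
    using m_pos by (auto simp: Min_gr_iff)
  have "e * (h \<bullet> (y - b)) \<le> - (e * \<mu>F * ?n2)"
    using mult_left_mono[OF mono, of e] pos by (simp add: algebra_simps)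
  also have "\<dots> \<le> - (e * \<mu>F * (2 * Min (range p) / Max (range Lw) * ?E))"
    unfolding neg_le_iff_le
    by (intro mult_left_mono error_fun_le_block_norm_sq[OF b y smooth]) (use pos in simp_all)
  finally have 1: "e * (h \<bullet> (y - b)) \<le> - (e * (2 * \<mu>F * Min (range p) / Max (range Lw)) * ?E)"
    by (simp add: mult_ac)
  have "(\<Sum>i\<in>UNIV. (nb.dual i (block c i h))\<^sup>2 / m i)
      \<le> (\<Sum>i\<in>UNIV. (nb.dual i (block c i h))\<^sup>2 / Min (range m))"
    using m0 m_pos by (intro sum_mono divide_left_mono) auto
  also have "\<dots> \<le> (full.dual h)\<^sup>2 / Min (range m)"
    unfolding sum_divide_distrib[symmetric]
    by (rule divide_right_mono[OF sum_dual_block_sq_le less_imp_le[OF m0]])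
  also have "\<dots> \<le> (LF * block_norm c N (b - y))\<^sup>2 / Min (range m)"
    by (rule divide_right_mono[OF power_mono[OF lip full.dual_nonneg] less_imp_le[OF m0]])
  also have "\<dots> \<le> LF\<^sup>2 * (2 * Max (range p) / Min (range m) * ?E) / Min (range m)"
    unfolding power_mult_distrib
    by (intro divide_right_mono mult_left_mono block_norm_sq_le_error_fun b y zero_le_power2
        less_imp_le[OF m0])
  also have "\<dots> = 2 * LF\<^sup>2 * Max (range p) / (Min (range m))\<^sup>2 * ?E"
    by (simp add: power2_eq_square)
  finally have 2: "e\<^sup>2 * (\<Sum>i\<in>UNIV. (nb.dual i (block c i h))\<^sup>2 / m i)
      \<le> e\<^sup>2 * (2 * LF\<^sup>2 * Max (range p) / (Min (range m))\<^sup>2 * ?E)"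
    by (rule mult_left_mono) simp
  have "(\<Sum>i\<in>UNIV. e * (block c i h \<bullet> block c i (y - b)) + e\<^sup>2 / m i * (\<nu> i + (nb.dual i (block c i h))\<^sup>2))
      = e * (h \<bullet> (y - b)) + e\<^sup>2 * (\<Sum>i\<in>UNIV. \<nu> i / m i) + e\<^sup>2 * (\<Sum>i\<in>UNIV. (nb.dual i (block c i h))\<^sup>2 / m i)"
    by (simp add: inner_eq_sum_block[of h "y - b" c] sum.distrib sum_distrib_left distrib_left)
  with 1 2 show ?thesis
    by (simp add: algebra_simps)
qed

text \<open>In a product set one block of \<open>y\<close> may be replaced while the others stay
  fixed, so the variational inequality splits into one per block.\<close>

lemma arg_min_block_variational:
  assumes "is_arg_min F (\<lambda>b. b \<in> block_prod c B) y"
    and "(F has_derivative (\<lambda>h. u \<bullet> h)) (at y within block_prod c B)" and "s \<in> B i"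
  shows "0 \<le> block c i u \<bullet> (s - block c i y)"
proof -
  have y: "y \<in> block_prod c B"
    using assms(1) by (simp add: is_arg_min_def)
  have s: "s \<in> block_space c i"
    using assms(3) B_subset by blast
  have bs: "block c k (y + (s - block c i y)) = (if k = i then s else block c k y)" for k
    using s by (auto simp: vec_eq_iff block_space_def)
  have "convex (block_prod c B)"
    unfolding convex_def block_prod_def using B_convex
    by (auto simp: block_add block_scaleR convex_def)
  moreover have "y + (s - block c i y) \<in> block_prod c B"
    unfolding block_prod_def using assms(3) block_in[OF y] by (auto simp: bs)
  ultimately have "0 \<le> u \<bullet> (s - block c i y)"
    using arg_min_variational[OF _ assms(1,2)] by fastforce
  then show ?thesis
    using inner_block_space[of "s - block c i y" c i u] s
    by (simp add: subspace_diff[OF subspace_block_space])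
qed

lemma measurable_error_fun:
  assumes b: "b \<in> borel_measurable H" "\<And>\<omega>. b \<omega> \<in> block_prod c B"
  shows "(\<lambda>\<omega>. error_fun c p w dw (b \<omega>) y) \<in> borel_measurable H"
proof -
  have "continuous_on (B i) (\<lambda>x. bregman (w i) (dw i) x (block c i y))" for i
    unfolding bregman_def
    by (intro continuous_intros mm.continuous_on_w continuous_on_subset[OF dw_cont B_subset])
  then have "(\<lambda>\<omega>. bregman (w i) (dw i) (block c i (b \<omega>)) (block c i y)) \<in> borel_measurable H" for i
    by (rule measurable_continuous_comp[rotated 2]) (use b block_in in measurable)
  then show ?thesis
    unfolding error_fun_def by measurable
qed

text \<open>The index takes finitely many values, so it may be frozen; for fixed \<open>i\<close>
  the step is a composition with the jointly continuous prox mapping.\<close>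

lemma measurable_update:
  assumes I: "I \<in> measurable H (count_space UNIV)"
    and b[measurable]: "b \<in> borel_measurable H" and bB: "\<And>\<omega>. b \<omega> \<in> block_prod c B"
    and g[measurable]: "g \<in> borel_measurable H"
  shows "(\<lambda>\<omega>. update (I \<omega>) (e *\<^sub>R block c (I \<omega>) (g \<omega>)) (b \<omega>)) \<in> borel_measurable H"
proof (rule measurable_compose_countable'[OF _ I])
  fix i
  have "(\<lambda>\<omega>. (block c i (b \<omega>), e *\<^sub>R block c i (g \<omega>))) \<in> borel_measurable H"
    by measurable
  then have "(\<lambda>\<omega>. case (block c i (b \<omega>), e *\<^sub>R block c i (g \<omega>)) of (x, v) \<Rightarrow>
      prox (B i) (w i) (dw i) x v) \<in> borel_measurable H"
    by (rule measurable_continuous_comp[OF _ _ mm.continuous_on_prox]) (use bB block_in in auto)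
  then show "(\<lambda>\<omega>. update i (e *\<^sub>R block c i (g \<omega>)) (b \<omega>)) \<in> borel_measurable H"
    unfolding update_eq[OF bB] by simp
qed (auto intro: countable_finite)

end

section \<open>Conditional expectations\<close>

lemma borel_measurable_vec_nth [measurable (raw)]:
  fixes v :: "'a \<Rightarrow> real ^ 'n"
  assumes "v \<in> borel_measurable M"
  shows "(\<lambda>x. v x $ j) \<in> borel_measurable M"
  by (rule measurable_compose[OF assms])
    (intro borel_measurable_continuous_onI continuous_on_component continuous_on_id)

lemma integrable_mult_of_squares:
  fixes f g :: "'a \<Rightarrow> real"
  assumes [measurable]: "f \<in> borel_measurable M" "g \<in> borel_measurable M"
    and "integrable M (\<lambda>x. (f x)\<^sup>2)" "integrable M (\<lambda>x. (g x)\<^sup>2)"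
  shows "integrable M (\<lambda>x. f x * g x)"
proof (rule Bochner_Integration.integrable_bound)
  show "integrable M (\<lambda>x. (f x)\<^sup>2 + (g x)\<^sup>2)"
    using assms by simp
  show "AE x in M. norm (f x * g x) \<le> norm ((f x)\<^sup>2 + (g x)\<^sup>2)"
  proof (rule AE_I2)
    fix x
    have "0 \<le> (\<bar>f x\<bar> - \<bar>g x\<bar>)\<^sup>2" by simp
    then have "2 * (\<bar>f x\<bar> * \<bar>g x\<bar>) \<le> (f x)\<^sup>2 + (g x)\<^sup>2"
      by (simp add: power2_diff)
    moreover have "0 \<le> \<bar>f x\<bar> * \<bar>g x\<bar>" by simp
    ultimately have "\<bar>f x\<bar> * \<bar>g x\<bar> \<le> (f x)\<^sup>2 + (g x)\<^sup>2"
      by linarith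
    then show "norm (f x * g x) \<le> norm ((f x)\<^sup>2 + (g x)\<^sup>2)"
      by (simp add: abs_mult)
  qed
qed measurable

text \<open>Conditioning on the finer algebra \<open>G\<close> comes in between: there
  \<open>W\<close> factors out and independence makes the conditional probability of
  \<open>E\<close> constant; the tower property descends to \<open>F\<close>. Thus \<open>W\<close>
  may depend on the current sample although \<open>F\<close> does not contain it.\<close>

lemma real_cond_exp_indep_mult:
  assumes "prob_space M" and MG: "subalgebra M G" and GF: "subalgebra G F"
    and E: "E \<in> sets M" and indep: "\<And>A. A \<in> sets G \<Longrightarrow> measure M (E \<inter> A) = measure M E * measure M A"
    and W: "W \<in> borel_measurable G" "integrable M W"
  shows "AE x in M. real_cond_exp M F (\<lambda>x. W x * indicator E x) x = real_cond_exp M F W x * measure M E"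
proof -
  interpret prob_space M by fact
  have MF: "subalgebra M F"
    using MG GF by (auto simp: subalgebra_def)
  interpret G: finite_measure_subalgebra M G
    by unfold_locales (rule MG)
  interpret F: finite_measure_subalgebra M F
    by unfold_locales (rule MF)
  have int: "integrable M (\<lambda>x. W x * indicator E x)"
    using integrable_mult_indicator[OF E W(2)] by (simp add: mult.commute)
  have E_int: "integrable M (indicator E :: _ \<Rightarrow> real)"
    using E by (simp add: integrable_real_indicator less_top[symmetric])
  have "AE x in M. real_cond_exp M G (indicator E) x = measure M E"
  proof (rule G.real_cond_exp_charact)
    fix A assume A: "A \<in> sets G"
    then have AM: "A \<in> sets M"
      using MG by (auto simp: subalgebra_def)
    have "(\<integral>x\<in>A. indicator E x \<partial>M) = (\<integral>x. indicator (E \<inter> A) x \<partial>M)"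
      unfolding set_lebesgue_integral_def
      by (intro Bochner_Integration.integral_cong) (auto split: split_indicator)
    also have "\<dots> = measure M E * measure M A"
      using E AM indep[OF A] by (simp add: Int_absorb1 sets.sets_into_space)
    also have "\<dots> = (\<integral>x\<in>A. measure M E \<partial>M)"
      using AM by (simp add: set_lebesgue_integral_def Int_absorb1 sets.sets_into_space)
    finally show "(\<integral>x\<in>A. indicator E x \<partial>M) = (\<integral>x\<in>A. measure M E \<partial>M)" .
  qed (use E_int in auto)
  moreover have "AE x in M. real_cond_exp M G (\<lambda>x. W x * indicator E x) x = W x * real_cond_exp M G (indicator E) x"
    by (rule G.real_cond_exp_mult[OF W(1) _ int]) (use E in simp)
  ultimately have 1: "AE x in M. real_cond_exp M G (\<lambda>x. W x * indicator E x) x = W x * measure M E"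
    by auto
  have WM[measurable]: "W \<in> borel_measurable M"
    using W(2) by simp
  have "AE x in M. real_cond_exp M F (real_cond_exp M G (\<lambda>x. W x * indicator E x)) x
      = real_cond_exp M F (\<lambda>x. W x * measure M E) x"
    by (rule F.real_cond_exp_cong[OF 1]) (auto simp: measurable_from_subalg[OF MG])
  moreover have "AE x in M. real_cond_exp M F (real_cond_exp M G (\<lambda>x. W x * indicator E x)) x
      = real_cond_exp M F (\<lambda>x. W x * indicator E x) x"
    by (rule F.real_cond_exp_nested_subalg[OF MG GF int])
  moreover have "AE x in M. real_cond_exp M F (\<lambda>x. W x * measure M E) x = real_cond_exp M F W x * measure M E"
    using F.real_cond_exp_cmult[OF W(2), of "measure M E"] by (simp add: mult.commute)
  ultimately show ?thesis
    by auto
qed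

text \<open>\<open>real_cond_exp\<close> is scalar, so the known factor is pulled out coordinate by
  coordinate; integrability is asked of the products because the pull-out rule needs it.\<close>

lemma real_cond_exp_inner_eq_0:
  fixes x z :: "'w \<Rightarrow> real ^ 'n"
  assumes "prob_space M" and MF: "subalgebra M F"
    and x: "x \<in> borel_measurable F" and z: "z \<in> borel_measurable M"
    and int: "\<And>j. integrable M (\<lambda>\<omega>. x \<omega> $ j * z \<omega> $ j)"
    and mean: "\<And>j. AE \<omega> in M. real_cond_exp M F (\<lambda>\<omega>. z \<omega> $ j) \<omega> = 0"
  shows "AE \<omega> in M. real_cond_exp M F (\<lambda>\<omega>. x \<omega> \<bullet> z \<omega>) \<omega> = 0"
proof -
  interpret prob_space M by fact
  interpret F: finite_measure_subalgebra M F
    by unfold_locales (rule MF)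
  have "AE \<omega> in M. \<forall>j. real_cond_exp M F (\<lambda>\<omega>. x \<omega> $ j * z \<omega> $ j) \<omega> = 0"
    unfolding AE_all_countable
  proof
    fix j
    have "AE \<omega> in M. real_cond_exp M F (\<lambda>\<omega>. x \<omega> $ j * z \<omega> $ j) \<omega>
        = x \<omega> $ j * real_cond_exp M F (\<lambda>\<omega>. z \<omega> $ j) \<omega>"
      by (rule F.real_cond_exp_mult[OF _ _ int]) (use x z in measurable)
    with mean[of j] show "AE \<omega> in M. real_cond_exp M F (\<lambda>\<omega>. x \<omega> $ j * z \<omega> $ j) \<omega> = 0"
      by auto
  qed
  moreover have "AE \<omega> in M. real_cond_exp M F (\<lambda>\<omega>. \<Sum>j\<in>UNIV. x \<omega> $ j * z \<omega> $ j) \<omega>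
      = (\<Sum>j\<in>UNIV. real_cond_exp M F (\<lambda>\<omega>. x \<omega> $ j * z \<omega> $ j) \<omega>)"
    by (rule F.real_cond_exp_sum[OF int])
  ultimately show ?thesis
    by (auto simp: inner_vec_def)
qed

text \<open>\<open>real_cond_exp\<close> subtracts a nonnegative term, coming from the negative
  part, from the finite value of the \<open>nn_cond_exp\<close> of the positive part; dropping it
  only increases the value.\<close>

lemma real_cond_exp_le_of_nn_cond_exp_le:
  assumes "\<And>x. 0 \<le> f x" "0 \<le> K"
    and "AE x in M. nn_cond_exp M F (\<lambda>x. ennreal (f x)) x \<le> ennreal K"
  shows "AE x in M. real_cond_exp M F f x \<le> K"
  using assms(3)
proof eventually_elim
  case (elim x)
  have "real_cond_exp M F f x \<le> enn2real (nn_cond_exp M F (\<lambda>x. ennreal (f x)) x)"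
    by (simp add: real_cond_exp_def)
  also have "\<dots> \<le> enn2real (ennreal K)"
    by (rule enn2real_mono[OF elim]) simp
  finally show ?case
    using assms(2) by simp
qed

text \<open>\<open>nn_cond_exp\<close> keeps infinite values, which \<open>real_cond_exp\<close>
  would send to 0; hence a bound in this form controls the full expectation.\<close>

lemma integrable_of_nn_cond_exp_le:
  fixes f :: "'a \<Rightarrow> real"
  assumes "prob_space M" and MF: "subalgebra M F"
    and [measurable]: "f \<in> borel_measurable M" and nonneg: "\<And>x. 0 \<le> f x"
    and le: "AE x in M. nn_cond_exp M F (\<lambda>x. ennreal (f x)) x \<le> ennreal K"
  shows "integrable M f"
proof (rule integrableI_bounded)
  interpret prob_space M by fact
  interpret F: finite_measure_subalgebra M F
    by unfold_locales (rule MF)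
  have "(\<integral>\<^sup>+x. ennreal (norm (f x)) \<partial>M) = (\<integral>\<^sup>+x. nn_cond_exp M F (\<lambda>x. ennreal (f x)) x \<partial>M)"
    using F.nn_cond_exp_intg[of "\<lambda>_. 1" "\<lambda>x. ennreal (f x)"] nonneg by simp
  also have "\<dots> \<le> (\<integral>\<^sup>+x. ennreal K \<partial>M)"
    by (rule nn_integral_mono_AE[OF le])
  also have "\<dots> < \<infinity>"
    by (simp add: emeasure_space_1)
  finally show "(\<integral>\<^sup>+x. ennreal (norm (f x)) \<partial>M) < \<infinity>" .
qed measurable

section \<open>The one-step inequality in conditional mean\<close>

context block_mirror
begin

lemma measurable_dual: "z \<in> borel_measurable H \<Longrightarrow> (\<lambda>\<omega>. nb.dual i (block c i (z \<omega>))) \<in> borel_measurable H"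
  by (rule measurable_continuous_comp[of "\<lambda>\<omega>. block c i (z \<omega>)" _ UNIV])
    (auto intro: nb.continuous_on_dual)

text \<open>\<open>F\<close> plays the past and \<open>G\<close> the past with the current sample
  but without the current index \<open>I\<close>; \<open>a\<close> is the conditional mean of the
  stochastic gradient \<open>g\<close>. Integrability of \<open>X\<close> is a conclusion so that
  the step can be iterated.\<close>

lemma conditional_step:
  assumes "prob_space M" and MG: "subalgebra M G" and GF: "subalgebra G F"
    and I: "I \<in> measurable M (count_space UNIV)"
    and I_prob: "\<And>i. measure M {\<omega> \<in> space M. I \<omega> = i} = p i"
    and I_indep: "\<And>i A. A \<in> sets G \<Longrightarrow>
      measure M ({\<omega> \<in> space M. I \<omega> = i} \<inter> A) = p i * measure M A"
    and b: "b \<in> borel_measurable F" and bB: "\<And>\<omega>. b \<omega> \<in> block_prod c B"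
    and g: "g \<in> borel_measurable G" and a: "a \<in> borel_measurable F"
    and y: "y \<in> block_prod c B"
    and u: "\<And>i s. s \<in> B i \<Longrightarrow> 0 \<le> block c i u \<bullet> (s - block c i y)"
    and e: "0 < e"
    and L_int: "integrable M (\<lambda>\<omega>. error_fun c p w dw (b \<omega>) y)"
    and z_int: "\<And>i. integrable M (\<lambda>\<omega>. (nb.dual i (block c i (g \<omega> - a \<omega>)))\<^sup>2)"
    and h_int: "\<And>i. integrable M (\<lambda>\<omega>. (nb.dual i (block c i (a \<omega> - u)))\<^sup>2)"
    and z_mean: "\<And>j. AE \<omega> in M. real_cond_exp M F (\<lambda>\<omega>. (g \<omega> - a \<omega>) $ j) \<omega> = 0"
    and z_var: "\<And>i. AE \<omega> in M.
      real_cond_exp M F (\<lambda>\<omega>. (nb.dual i (block c i (g \<omega> - a \<omega>)))\<^sup>2) \<omega> \<le> \<nu> i"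
  defines "X \<equiv> \<lambda>\<omega>. error_fun c p w dw (update (I \<omega>) (e *\<^sub>R block c (I \<omega>) (g \<omega>)) (b \<omega>)) y"
  shows "integrable M X"
    and "AE \<omega> in M. real_cond_exp M F X \<omega> \<le> error_fun c p w dw (b \<omega>) y
      + (\<Sum>i\<in>UNIV. e * (block c i (a \<omega> - u) \<bullet> block c i (y - b \<omega>))
          + e\<^sup>2 / m i * (\<nu> i + (nb.dual i (block c i (a \<omega> - u)))\<^sup>2))"
proof -
  interpret prob_space M by fact
  have MF: "subalgebra M F"
    using MG GF by (auto simp: subalgebra_def)
  interpret F: finite_measure_subalgebra M F
    by unfold_locales (rule MF)
  note fromF = measurable_from_subalg[OF MF] and fromG = measurable_from_subalg[OF MG]
    and FG = measurable_from_subalg[OF GF]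
  define z where "z \<omega> = g \<omega> - a \<omega>" for \<omega>
  define h where "h \<omega> = a \<omega> - u" for \<omega>
  define d where "d \<omega> = y - b \<omega>" for \<omega>
  have zG: "z \<in> borel_measurable G"
    unfolding z_def using g FG[OF a] by measurable
  have hF: "h \<in> borel_measurable F" and dF: "d \<in> borel_measurable F"
    unfolding h_def d_def using a b by measurable
  have zM: "z \<in> borel_measurable M" and hM: "h \<in> borel_measurable M" and dM: "d \<in> borel_measurable M"
    using fromG[OF zG] fromF[OF hF] fromF[OF dF] by auto
  \<comment> \<open>\<open>P\<close> is the linear noise, \<open>Q\<close> the quadratic noise, and
    \<open>R\<close> collects what the past determines. In \<open>P\<close> only \<open>d\<close> is
    cut to the block: the inner product is the same, and the mean-zero assumption on the coordinates
    of \<open>z\<close> applies as it stands.\<close>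
  define P where "P i \<omega> = block c i (d \<omega>) \<bullet> z \<omega>" for i \<omega>
  define Q where "Q i \<omega> = (nb.dual i (block c i (z \<omega>)))\<^sup>2" for i \<omega>
  define R where "R i \<omega> = e * (block c i (h \<omega>) \<bullet> block c i (d \<omega>))
    + e\<^sup>2 / m i * (nb.dual i (block c i (h \<omega>)))\<^sup>2" for i \<omega>
  define W where "W i \<omega> = e * P i \<omega> + e\<^sup>2 / m i * Q i \<omega> + R i \<omega>" for i \<omega>
  have d_int: "integrable M (\<lambda>\<omega>. (norm (d \<omega>))\<^sup>2)"
  proof -
    obtain C where C: "C > 0" "\<And>x. norm x \<le> C * block_norm c N x"
      using full.norm_le_N by auto
    define K where "K = C\<^sup>2 * (2 * Max (range p) / Min (range m))"
    have "(norm (d \<omega>))\<^sup>2 \<le> K * error_fun c p w dw (b \<omega>) y" for \<omega>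
    proof -
      have "(norm (d \<omega>))\<^sup>2 \<le> (C * block_norm c N (b \<omega> - y))\<^sup>2"
        using C(2)[of "b \<omega> - y"] unfolding d_def norm_minus_commute[of y] by (intro power_mono) auto
      also have "\<dots> = C\<^sup>2 * (block_norm c N (b \<omega> - y))\<^sup>2"
        by (simp add: power_mult_distrib)
      also have "\<dots> \<le> C\<^sup>2 * (2 * Max (range p) / Min (range m) * error_fun c p w dw (b \<omega>) y)"
        by (intro mult_left_mono block_norm_sq_le_error_fun bB y) simp
      finally show ?thesis
        by (simp add: K_def mult.assoc)
    qed
    then show ?thesis
      by (intro Bochner_Integration.integrable_bound[OF integrable_mult_right[OF L_int, of K]])
        (use dM in \<open>auto intro: AE_I2 order_trans[OF _ abs_ge_self]\<close>)
  qed
  have block_int: "integrable M (\<lambda>\<omega>. (norm (block c i (v \<omega>)))\<^sup>2)"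
    if "integrable M (\<lambda>\<omega>. (nb.dual i (block c i (v \<omega>)))\<^sup>2)" and [measurable]: "v \<in> borel_measurable M" for v i
  proof -
    obtain C where C: "C > 0" "\<And>x. x \<in> block_space c i \<Longrightarrow> norm x \<le> C * nb.dual i x"
      using nb.norm_le_dual by blast
    have "(norm (block c i (v \<omega>)))\<^sup>2 \<le> C\<^sup>2 * (nb.dual i (block c i (v \<omega>)))\<^sup>2" for \<omega>
      using power_mono[OF C(2)[of "block c i (v \<omega>)"], of 2] by (simp add: power_mult_distrib)
    then show ?thesis
      by (intro Bochner_Integration.integrable_bound[OF integrable_mult_right[OF that(1), of "C\<^sup>2"]])
        (auto intro: AE_I2)
  qed
  have nth_int: "integrable M (\<lambda>\<omega>. (v \<omega> $ j)\<^sup>2)"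
    if "integrable M (\<lambda>\<omega>. (norm (v \<omega>))\<^sup>2)" and [measurable]: "v \<in> borel_measurable M"
    for v :: "'a \<Rightarrow> real ^ 'n" and j
  proof (rule Bochner_Integration.integrable_bound[OF that(1)])
    show "AE \<omega> in M. norm ((v \<omega> $ j)\<^sup>2) \<le> norm ((norm (v \<omega>))\<^sup>2)"
      using component_le_norm_cart[of _ j] by (auto intro!: AE_I2 abs_le_square_iff[THEN iffD1])
  qed measurable
  \<comment> \<open>\<open>block c i (d \<omega>)\<close> vanishes off block \<open>i\<close>, so a
    square-integrable \<open>i\<close>th block of \<open>v\<close> suffices.\<close>
  have prod_int: "integrable M (\<lambda>\<omega>. block c i (d \<omega>) $ j * v \<omega> $ j)"
    if v: "integrable M (\<lambda>\<omega>. (nb.dual i (block c i (v \<omega>)))\<^sup>2)" and [measurable]: "v \<in> borel_measurable M" for v i j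
  proof -
    have "integrable M (\<lambda>\<omega>. (d \<omega> $ j)\<^sup>2)" "integrable M (\<lambda>\<omega>. (block c i (v \<omega>) $ j)\<^sup>2)"
      using nth_int[OF d_int dM] nth_int[OF block_int[OF v]] by measurable
    then have "integrable M (\<lambda>\<omega>. d \<omega> $ j * block c i (v \<omega>) $ j)"
      by (intro integrable_mult_of_squares) (use dM in measurable)
    then show ?thesis
      by (rule Bochner_Integration.integrable_cong[THEN iffD1, rotated 2]) auto
  qed
  have inner_int: "integrable M (\<lambda>\<omega>. block c i (d \<omega>) \<bullet> v \<omega>)"
    if "integrable M (\<lambda>\<omega>. (nb.dual i (block c i (v \<omega>)))\<^sup>2)" "v \<in> borel_measurable M" for v i
    unfolding inner_vec_def using prod_int[OF that] by simp
  have P_int: "integrable M (P i)" and Q_int: "integrable M (Q i)" for i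
    using inner_int[OF z_int[folded z_def] zM] z_int[folded z_def] unfolding P_def Q_def by auto
  have R_eq: "R i = (\<lambda>\<omega>. e * (block c i (d \<omega>) \<bullet> h \<omega>) + e\<^sup>2 / m i * (nb.dual i (block c i (h \<omega>)))\<^sup>2)" for i
    unfolding R_def fun_eq_iff
    using inner_block_space[OF block_in_space] by (metis inner_commute)
  have R_int: "integrable M (R i)" for i
    unfolding R_eq using inner_int[OF h_int[folded h_def] hM] h_int[folded h_def] by auto
  have W_int: "integrable M (W i)" for i
    unfolding W_def using P_int Q_int R_int by auto
  have RF: "R i \<in> borel_measurable F" for i
    unfolding R_def using hF dF measurable_dual[OF hF] by measurable
  have WG: "W i \<in> borel_measurable G" for i
    unfolding W_def P_def Q_def
    using zG FG[OF dF] measurable_dual[OF zG] FG[OF RF] by measurable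
  define E where "E i = {\<omega> \<in> space M. I \<omega> = i}" for i
  have EM: "E i \<in> sets M" for i
    unfolding E_def using I by measurable
  have X_le: "X \<omega> \<le> error_fun c p w dw (b \<omega>) y + (\<Sum>i\<in>UNIV. W i \<omega> * indicator (E i) \<omega> / p i)"
    if \<omega>: "\<omega> \<in> space M" for \<omega>
  proof -
    define i where "i = I \<omega>"
    \<comment> \<open>The stepsize is put on \<open>u\<close> as well, which keeps the variational
      inequality since \<open>e\<close> is positive; the difference is then \<open>e\<close> times
      \<open>g - u\<close>, that is, noise plus gradient difference.\<close>
    have s: "block c i (e *\<^sub>R g \<omega> - e *\<^sub>R u) = e *\<^sub>R block c i (z \<omega> + h \<omega>)"
      by (simp add: z_def h_def block_scaleR[symmetric] scaleR_diff_right)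
    have "X \<omega> \<le> error_fun c p w dw (b \<omega>) y + (e * (block c i (z \<omega> + h \<omega>) \<bullet> block c i (d \<omega>))
        + (e * nb.dual i (block c i (z \<omega> + h \<omega>)))\<^sup>2 / (2 * m i)) / p i"
      using error_fun_update[OF bB y, of i "e *\<^sub>R u" "e *\<^sub>R g \<omega>"] u[of _ i] e
      unfolding X_def i_def[symmetric] s d_def[symmetric]
      by (simp add: block_scaleR nb.dual_scaleR)
    also have "\<dots> \<le> error_fun c p w dw (b \<omega>) y + W i \<omega> / p i"
    proof -
      let ?z = "nb.dual i (block c i (z \<omega>))" and ?h = "nb.dual i (block c i (h \<omega>))"
      \<comment> \<open>Separating noise from gradient difference costs a factor 2, which cancels
        the 2 of \<open>2 * m i\<close> and leaves \<open>e\<^sup>2 / m i\<close> in front of both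
        squares.\<close>
      have "(nb.dual i (block c i (z \<omega> + h \<omega>)))\<^sup>2 \<le> (?z + ?h)\<^sup>2"
        unfolding block_add by (intro power_mono nb.dual_triangle nb.dual_nonneg)
      also have "\<dots> \<le> 2 * (?z\<^sup>2 + ?h\<^sup>2)"
        using sum_squares_bound[of ?z ?h] by (simp add: power2_sum)
      finally have "e\<^sup>2 / (2 * m i) * (nb.dual i (block c i (z \<omega> + h \<omega>)))\<^sup>2 \<le> e\<^sup>2 / (2 * m i) * (2 * (?z\<^sup>2 + ?h\<^sup>2))"
        using m_pos[of i] by (intro mult_left_mono) auto
      also have "\<dots> = e\<^sup>2 / m i * ?z\<^sup>2 + e\<^sup>2 / m i * ?h\<^sup>2"
        using m_pos[of i] by (simp add: field_simps)
      finally have "(e * nb.dual i (block c i (z \<omega> + h \<omega>)))\<^sup>2 / (2 * m i)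
          \<le> e\<^sup>2 / m i * ?z\<^sup>2 + e\<^sup>2 / m i * ?h\<^sup>2"
        by (simp add: power_mult_distrib)
      moreover have "P i \<omega> = block c i (z \<omega>) \<bullet> block c i (d \<omega>)"
        unfolding P_def using inner_block_space[of "block c i (d \<omega>)" c i "z \<omega>"] by (simp add: inner_commute)
      ultimately show ?thesis
        using p_pos[of i]
        by (intro add_left_mono divide_right_mono) (auto simp: W_def Q_def R_def block_add inner_add_left algebra_simps)
    qed
    \<comment> \<open>Writing the term at the random index as a sum over fixed indices with
      indicators makes each summand a \<open>G\<close>-measurable factor times an independent
      event.\<close>
    also have "W i \<omega> / p i = (\<Sum>k\<in>UNIV. if k = i then W k \<omega> / p k else 0)"
      by simp
    also have "\<dots> = (\<Sum>k\<in>UNIV. W k \<omega> * indicator (E k) \<omega> / p k)"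
      using \<omega> by (intro sum.cong) (auto simp: E_def i_def)
    finally show ?thesis .
  qed
  have WE_int: "integrable M (\<lambda>\<omega>. W i \<omega> * indicator (E i) \<omega>)" for i
    using integrable_mult_indicator[OF EM W_int] by (simp add: mult.commute)
  then have WEp_int: "integrable M (\<lambda>\<omega>. W i \<omega> * indicator (E i) \<omega> / p i)" for i
    by simp
  let ?U = "\<lambda>\<omega>. error_fun c p w dw (b \<omega>) y + (\<Sum>i\<in>UNIV. W i \<omega> * indicator (E i) \<omega> / p i)"
  have U_int: "integrable M ?U"
    by (intro Bochner_Integration.integrable_add Bochner_Integration.integrable_sum L_int WEp_int)
  have XM: "X \<in> borel_measurable M"
    unfolding X_def
    by (intro measurable_error_fun measurable_update update_in I bB fromF[OF b] fromG[OF g])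
  show X_int: "integrable M X"
  proof (rule Bochner_Integration.integrable_bound[OF U_int XM])
    have "0 \<le> X \<omega>" for \<omega>
      unfolding X_def by (intro error_fun_nonneg update_in bB y)
    with X_le show "AE \<omega> in M. norm (X \<omega>) \<le> norm (?U \<omega>)"
      by (intro AE_I2) (simp add: order_trans[OF _ abs_ge_self])
  qed
  have c1: "AE \<omega> in M. real_cond_exp M F X \<omega> \<le> real_cond_exp M F ?U \<omega>"
    using X_le by (intro F.real_cond_exp_mono X_int U_int AE_I2)
  have c2: "AE \<omega> in M. real_cond_exp M F ?U \<omega> = real_cond_exp M F (\<lambda>\<omega>. error_fun c p w dw (b \<omega>) y) \<omega>
      + real_cond_exp M F (\<lambda>\<omega>. \<Sum>i\<in>UNIV. W i \<omega> * indicator (E i) \<omega> / p i) \<omega>"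
    by (intro F.real_cond_exp_add Bochner_Integration.integrable_sum L_int WEp_int)
  have c3: "AE \<omega> in M. real_cond_exp M F (\<lambda>\<omega>. error_fun c p w dw (b \<omega>) y) \<omega> = error_fun c p w dw (b \<omega>) y"
    by (intro F.real_cond_exp_F_meas L_int measurable_error_fun b bB)
  have c4: "AE \<omega> in M. real_cond_exp M F (\<lambda>\<omega>. \<Sum>i\<in>UNIV. W i \<omega> * indicator (E i) \<omega> / p i) \<omega>
      = (\<Sum>i\<in>UNIV. real_cond_exp M F (\<lambda>\<omega>. W i \<omega> * indicator (E i) \<omega> / p i) \<omega>)"
    by (rule F.real_cond_exp_sum[OF WEp_int])
  \<comment> \<open>Independence contributes the factor \<open>p i\<close>, which cancels the
    division by \<open>p i\<close>; \<open>P i\<close> has conditional mean 0, and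
    \<open>R i\<close> is its own conditional expectation.\<close>
  have c5: "AE \<omega> in M. \<forall>i. real_cond_exp M F (\<lambda>\<omega>. W i \<omega> * indicator (E i) \<omega> / p i) \<omega>
      \<le> e\<^sup>2 / m i * \<nu> i + R i \<omega>"
  proof (rule AE_all_countable[THEN iffD2], rule allI)
    fix i
    have E_prob: "measure M (E i) = p i"
      unfolding E_def by (rule I_prob)
    have "AE \<omega> in M. real_cond_exp M F (\<lambda>\<omega>. W i \<omega> * indicator (E i) \<omega>) \<omega>
        = real_cond_exp M F (W i) \<omega> * measure M (E i)"
      by (rule real_cond_exp_indep_mult[OF prob_space_axioms MG GF EM _ WG W_int])
        (unfold E_prob, unfold E_def, rule I_indep)
    moreover have "AE \<omega> in M. real_cond_exp M F (\<lambda>\<omega>. W i \<omega> * indicator (E i) \<omega> / p i) \<omega>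
        = real_cond_exp M F (\<lambda>\<omega>. W i \<omega> * indicator (E i) \<omega>) \<omega> / p i"
      by (rule F.real_cond_exp_cdiv[OF WE_int])
    moreover have "AE \<omega> in M. real_cond_exp M F (W i) \<omega>
        = real_cond_exp M F (\<lambda>\<omega>. e * P i \<omega> + e\<^sup>2 / m i * Q i \<omega>) \<omega> + real_cond_exp M F (R i) \<omega>"
      unfolding W_def using P_int Q_int R_int by (intro F.real_cond_exp_add) auto
    moreover have "AE \<omega> in M. real_cond_exp M F (\<lambda>\<omega>. e * P i \<omega> + e\<^sup>2 / m i * Q i \<omega>) \<omega>
        = real_cond_exp M F (\<lambda>\<omega>. e * P i \<omega>) \<omega> + real_cond_exp M F (\<lambda>\<omega>. e\<^sup>2 / m i * Q i \<omega>) \<omega>"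
      using P_int Q_int by (intro F.real_cond_exp_add) auto
    moreover have "AE \<omega> in M. real_cond_exp M F (\<lambda>\<omega>. e * P i \<omega>) \<omega> = e * real_cond_exp M F (P i) \<omega>"
      by (rule F.real_cond_exp_cmult[OF P_int])
    moreover have "AE \<omega> in M. real_cond_exp M F (\<lambda>\<omega>. e\<^sup>2 / m i * Q i \<omega>) \<omega> = e\<^sup>2 / m i * real_cond_exp M F (Q i) \<omega>"
      by (rule F.real_cond_exp_cmult[OF Q_int])
    moreover have "AE \<omega> in M. real_cond_exp M F (P i) \<omega> = 0"
      unfolding P_def
      by (rule real_cond_exp_inner_eq_0[OF prob_space_axioms MF _ zM prod_int[OF z_int[folded z_def] zM]
            z_mean[folded z_def]]) (use dF in measurable)
    moreover have "AE \<omega> in M. real_cond_exp M F (R i) \<omega> = R i \<omega>"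
      by (rule F.real_cond_exp_F_meas[OF R_int RF])
    moreover have "AE \<omega> in M. real_cond_exp M F (Q i) \<omega> \<le> \<nu> i"
      unfolding Q_def by (rule z_var[folded z_def])
    ultimately show "AE \<omega> in M. real_cond_exp M F (\<lambda>\<omega>. W i \<omega> * indicator (E i) \<omega> / p i) \<omega>
        \<le> e\<^sup>2 / m i * \<nu> i + R i \<omega>"
    proof eventually_elim
      case (elim \<omega>)
      have "e\<^sup>2 / m i * real_cond_exp M F (Q i) \<omega> \<le> e\<^sup>2 / m i * \<nu> i"
        using elim m_pos[of i] by (intro mult_left_mono) auto
      then show ?case
        using elim p_pos[of i] by (simp add: E_prob)
    qed
  qed
  show "AE \<omega> in M. real_cond_exp M F X \<omega> \<le> error_fun c p w dw (b \<omega>) y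
      + (\<Sum>i\<in>UNIV. e * (block c i (a \<omega> - u) \<bullet> block c i (y - b \<omega>))
          + e\<^sup>2 / m i * (\<nu> i + (nb.dual i (block c i (a \<omega> - u)))\<^sup>2))"
    using c1 c2 c3 c4 c5
  proof eventually_elim
    case (elim \<omega>)
    have "(\<Sum>i\<in>UNIV. real_cond_exp M F (\<lambda>\<omega>. W i \<omega> * indicator (E i) \<omega> / p i) \<omega>)
        \<le> (\<Sum>i\<in>UNIV. e\<^sup>2 / m i * \<nu> i + R i \<omega>)"
      using elim(5) by (intro sum_mono) blast
    also have "\<dots> = (\<Sum>i\<in>UNIV. e * (block c i (a \<omega> - u) \<bullet> block c i (y - b \<omega>))
          + e\<^sup>2 / m i * (\<nu> i + (nb.dual i (block c i (a \<omega> - u)))\<^sup>2))"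
      by (simp add: R_def h_def d_def algebra_simps)
    finally show ?case
      using elim(1-4) by linarith
  qed
qed

end

section \<open>The sampled sigma-algebras\<close>

lemma space_sample_algebra [simp]: "space (sample_algebra M ix xi I J) = space M"
  by (simp add: sample_algebra_def space_measure_of_conv)

lemma sets_sample_algebra: "sets (sample_algebra M ix xi I J) = sigma_sets (space M)
     ({ix s -` A \<inter> space M | s A. s \<in> I} \<union> {xi s -` A \<inter> space M | s A. s \<in> J \<and> A \<in> sets borel})"
  unfolding sample_algebra_def by (rule sets_measure_of) blast

lemma subalgebra_sample_algebra:
  assumes "\<And>t. ix t \<in> measurable M (count_space UNIV)" "\<And>t. xi t \<in> borel_measurable M"
  shows "subalgebra M (sample_algebra M ix xi I J)"
  unfolding subalgebra_def sets_sample_algebra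
  by (intro conjI sets.sigma_sets_subset) (use assms in \<open>auto intro: measurable_sets\<close>)

lemma subalgebra_sample_algebra_mono:
  assumes "I \<subseteq> I'" "J \<subseteq> J'"
  shows "subalgebra (sample_algebra M ix xi I' J') (sample_algebra M ix xi I J)"
  unfolding subalgebra_def sets_sample_algebra
  by (intro conjI sigma_sets_mono') (use assms in auto)

lemma measurable_sample_index:
  assumes "s \<in> I"
  shows "ix s \<in> measurable (sample_algebra M ix xi I J) (count_space UNIV)"
proof (rule measurableI)
  fix A
  show "ix s -` A \<inter> space (sample_algebra M ix xi I J) \<in> sets (sample_algebra M ix xi I J)"
    unfolding sets_sample_algebra space_sample_algebra
    using assms by (intro sigma_sets.Basic) blast
qed simp

lemma measurable_sample:
  fixes xi :: "nat \<Rightarrow> 'w \<Rightarrow> 's::topological_space"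
  assumes "s \<in> J"
  shows "xi s \<in> borel_measurable (sample_algebra M ix xi I J)"
proof (rule measurableI)
  fix A :: "'s set" assume "A \<in> sets borel"
  then show "xi s -` A \<inter> space (sample_algebra M ix xi I J) \<in> sets (sample_algebra M ix xi I J)"
    unfolding sets_sample_algebra space_sample_algebra
    using assms by (intro sigma_sets.Basic) blast
qed simp

text \<open>Integrability accompanies the bound because \<open>real_cond_exp\<close> is total and
  represents a conditional expectation faithfully only for integrable functions.\<close>

theorem lemma5:
  fixes M :: "'w measure"
    and c :: "'n::finite \<Rightarrow> 'l::finite"
    and B :: "'l \<Rightarrow> (real ^ 'n) set"
    and N :: "'l \<Rightarrow> real ^ 'n \<Rightarrow> real"
    and w :: "'l \<Rightarrow> real ^ 'n \<Rightarrow> real"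
    and dw :: "'l \<Rightarrow> real ^ 'n \<Rightarrow> real ^ 'n"
    and \<mu>\<omega> L\<omega> p \<nu> :: "'l \<Rightarrow> real"
    and f :: "real ^ 'n \<Rightarrow> real ^ 'd::finite \<Rightarrow> real"
    and G :: "real ^ 'n \<Rightarrow> real ^ 'd \<Rightarrow> real ^ 'n"
    and F :: "real ^ 'n \<Rightarrow> real"
    and gradF :: "real ^ 'n \<Rightarrow> real ^ 'n"
    and \<xi> :: "'w \<Rightarrow> real ^ 'd"
    and ix :: "nat \<Rightarrow> 'w \<Rightarrow> 'l"
    and xi :: "nat \<Rightarrow> 'w \<Rightarrow> real ^ 'd"
    and \<eta> :: "nat \<Rightarrow> real"
    and \<mu>F LF :: real
    and \<beta>0 \<beta>star :: "real ^ 'n"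
    and \<beta> z :: "nat \<Rightarrow> 'w \<Rightarrow> real ^ 'n"
  assumes prob: "prob_space M"
    \<comment> \<open>feasible set and norms\<close>
    and B: "\<And>i. B i \<subseteq> block_space c i" "\<And>i. B i \<noteq> {}" "\<And>i. closed (B i)" "\<And>i. convex (B i)"
    and norms: "\<And>i. is_norm_on (block_space c i) (N i)"
    \<comment> \<open>mirror maps\<close>
    and dw_block: "\<And>i x. x \<in> block_space c i \<Longrightarrow> dw i x \<in> block_space c i"
    and dw_grad: "\<And>i x. x \<in> block_space c i \<Longrightarrow>
      (w i has_derivative (\<lambda>h. dw i x \<bullet> h)) (at x within block_space c i)"
    and dw_cont: "\<And>i. continuous_on (block_space c i) (dw i)"
    and \<mu>\<omega>_pos: "\<And>i. \<mu>\<omega> i > 0"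
    and w_strong: "\<And>i x y. x \<in> B i \<Longrightarrow> y \<in> B i \<Longrightarrow>
      \<mu>\<omega> i / 2 * (N i (y - x))\<^sup>2 \<le> bregman (w i) (dw i) x y"
    and w_smooth: "\<And>i x y. x \<in> B i \<Longrightarrow> y \<in> B i \<Longrightarrow>
      bregman (w i) (dw i) x y \<le> L\<omega> i / 2 * (N i (y - x))\<^sup>2"
    \<comment> \<open>objective\<close>
    and \<xi>: "\<xi> \<in> borel_measurable M"
    and f_int: "\<And>b. b \<in> block_prod c B \<Longrightarrow> integrable M (\<lambda>\<omega>. f b (\<xi> \<omega>))"
    and F_def: "\<And>b. b \<in> block_prod c B \<Longrightarrow> F b = (\<integral>\<omega>. f b (\<xi> \<omega>) \<partial>M)"
    and F_diff: "\<And>b. b \<in> block_prod c B \<Longrightarrow>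
      (F has_derivative (\<lambda>h. gradF b \<bullet> h)) (at b within block_prod c B)"
    and \<mu>F_pos: "\<mu>F > 0"
    and F_strong: "\<And>b1 b2. b1 \<in> block_prod c B \<Longrightarrow> b2 \<in> block_prod c B \<Longrightarrow>
      F b1 \<ge> F b2 + gradF b2 \<bullet> (b1 - b2) + \<mu>F / 2 * (block_norm c N (b1 - b2))\<^sup>2"
    and LF_pos: "LF > 0"
    and F_smooth: "\<And>b1 b2. b1 \<in> block_prod c B \<Longrightarrow> b2 \<in> block_prod c B \<Longrightarrow>
      dual_norm_on UNIV (block_norm c N) (gradF b1 - gradF b2) \<le> LF * block_norm c N (b1 - b2)"
    and \<beta>star: "is_arg_min F (\<lambda>b. b \<in> block_prod c B) \<beta>star"
    \<comment> \<open>sampling\<close>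
    and p_pos: "\<And>i. p i > 0"
    and p_sum: "(\<Sum>i\<in>UNIV. p i) = 1"
    and ix_rv: "\<And>t. ix t \<in> measurable M (count_space UNIV)"
    and ix_prob: "\<And>t i. measure M {\<omega> \<in> space M. ix t \<omega> = i} = p i"
    and ix_indep: "\<And>t. prob_space.indep_set M
      (sets (sample_algebra M ix xi {t} {})) (sets (sample_algebra M ix xi {..<t} {..t}))"
    and xi_rv: "\<And>t. xi t \<in> borel_measurable M"
    and xi_copy: "\<And>t. distr M borel (xi t) = distr M borel \<xi>"
    and xi_indep: "\<And>t. prob_space.indep_set M
      (sets (sample_algebra M ix xi {} {t})) (sets (past_algebra M ix xi t))"
    \<comment> \<open>the scheme\<close>
    and \<beta>0: "\<beta>0 \<in> block_prod c B"
    and \<eta>_pos: "\<And>t. \<eta> t > 0"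
    and \<beta>_def: "\<And>t. \<beta> t = rbsmd c B w dw \<eta> G ix xi \<beta>0 t"
    and G_meas: "(\<lambda>(b, x). G b x)
      \<in> borel_measurable (restrict_space borel (block_prod c B) \<Otimes>\<^sub>M borel)"
    and G_grad: "\<And>t. AE \<omega> in M. ((\<lambda>b. f b (xi t \<omega>)) has_derivative
      (\<lambda>h. G (\<beta> t \<omega>) (xi t \<omega>) \<bullet> h)) (at (\<beta> t \<omega>) within block_prod c B)"
    \<comment> \<open>stochastic errors\<close>
    and z_def: "\<And>t \<omega>. z t \<omega> = G (\<beta> t \<omega>) (xi t \<omega>) - gradF (\<beta> t \<omega>)"
    and z_mean: "AE \<omega> in M. \<forall>t j. real_cond_exp M (past_algebra M ix xi t) (\<lambda>\<omega>. z t \<omega> $ j) \<omega> = 0"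
    and \<nu>_pos: "\<And>i. \<nu> i > 0"
    and z_var: "\<And>i. AE \<omega> in M. \<forall>t. nn_cond_exp M (past_algebra M ix xi t)
      (\<lambda>\<omega>. ennreal ((dual_norm_on (block_space c i) (N i) (block c i (z t \<omega>)))\<^sup>2)) \<omega>
        \<le> ennreal ((\<nu> i)\<^sup>2)"
  shows "(\<forall>t. integrable M (\<lambda>\<omega>. error_fun c p w dw (\<beta> (Suc t) \<omega>) \<beta>star)) \<and>
    (AE \<omega> in M. \<forall>t.
      real_cond_exp M (past_algebra M ix xi t)
          (\<lambda>\<omega>. error_fun c p w dw (\<beta> (Suc t) \<omega>) \<beta>star) \<omega>
        \<le> (1 - \<eta> t * (2 * \<mu>F * Min (range p) / Max (range L\<omega>))
             + (\<eta> t)\<^sup>2 * (2 * LF\<^sup>2 * Max (range p) / (Min (range \<mu>\<omega>))\<^sup>2))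
            * error_fun c p w dw (\<beta> t \<omega>) \<beta>star
          + (\<eta> t)\<^sup>2 * (\<Sum>i\<in>UNIV. (\<nu> i)\<^sup>2 / \<mu>\<omega> i))"
proof -
  interpret prob_space M by (rule prob)
  interpret block_mirror c N B w dw \<mu>\<omega> p
    by unfold_locales (use B norms dw_grad dw_cont \<mu>\<omega>_pos w_strong p_pos in auto)
  let ?S = "block_prod c B"
  have y: "\<beta>star \<in> ?S"
    using \<beta>star by (simp add: is_arg_min_def)
  define u where "u = gradF \<beta>star"
  have u: "0 \<le> block c i u \<bullet> (s - block c i \<beta>star)" if "s \<in> B i" for i s
    unfolding u_def by (rule arg_min_block_variational[OF \<beta>star F_diff[OF y] that])
  have \<beta>_0: "\<beta> 0 = (\<lambda>\<omega>. \<beta>0)"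
    by (simp add: \<beta>_def)
  have \<beta>_Suc: "\<beta> (Suc t) = (\<lambda>\<omega>. update (ix t \<omega>)
      (\<eta> t *\<^sub>R block c (ix t \<omega>) (G (\<beta> t \<omega>) (xi t \<omega>))) (\<beta> t \<omega>))" for t
    by (simp add: \<beta>_def update_def Let_def)
  \<comment> \<open>Feasibility holds at every \<open>\<omega>\<close>, not just almost everywhere,
    as the measurability lemmas require.\<close>
  have \<beta>_in: "\<beta> t \<omega> \<in> ?S" for t \<omega>
    by (induction t) (simp_all add: \<beta>_0 \<beta>0 \<beta>_Suc update_in)
  have F_lip: "full.dual (gradF b1 - gradF b2) \<le> LF * block_norm c N (b1 - b2)"
    if "b1 \<in> ?S" "b2 \<in> ?S" for b1 b2
    using F_smooth[OF that] .
  \<comment> \<open>Needed for measurability of \<open>gradF (\<beta> t \<omega>)\<close>. The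
    Lipschitz condition is translated from the block norms to the Euclidean norm on both
    sides.\<close>
  have gradF_cont: "continuous_on ?S gradF"
  proof -
    obtain C where C: "C > 0" "\<And>v. norm v \<le> C * full.dual v"
      using full.norm_le_dual by auto
    obtain K where K: "K > 0" "\<And>x. block_norm c N x \<le> K * norm x"
      using full.N_le_norm by auto
    have "norm (gradF b1 - gradF b2) \<le> C * (LF * (K * norm (b1 - b2)))"
      if "b1 \<in> ?S" "b2 \<in> ?S" for b1 b2
      by (rule order_trans[OF C(2)] mult_left_mono order_trans[OF F_lip[OF that]] K(2) less_imp_le C(1) LF_pos)+
    then have "(C * LF * K)-lipschitz_on ?S gradF"
      using C(1) LF_pos K(1) by (intro lipschitz_onI) (auto simp: dist_norm mult.assoc)
    then show ?thesis
      by (rule lipschitz_on_continuous_on)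
  qed
  \<comment> \<open>The index range stops before \<open>t\<close> while the sample range includes
    \<open>t\<close>: \<open>?G t\<close> knows the current sample but not yet which block it will
    update.\<close>
  let ?F = "past_algebra M ix xi" and ?G = "\<lambda>t. sample_algebra M ix xi {..<t} {..t}"
  have MG: "subalgebra M (?G t)" and MF: "subalgebra M (?F t)" for t
    by (rule subalgebra_sample_algebra[OF ix_rv xi_rv])+
  have GF: "subalgebra (?G t) (?F t)" for t
    by (rule subalgebra_sample_algebra_mono) auto
  \<comment> \<open>Stated for any algebra \<open>H\<close> because it is used with the next past,
    in the induction for \<open>\<beta>\<close>, and with \<open>?G t\<close>.\<close>
  have grad_meas: "(\<lambda>\<omega>. G (\<beta> t \<omega>) (xi t \<omega>)) \<in> borel_measurable H"
    if "\<beta> t \<in> borel_measurable H" "xi t \<in> borel_measurable H" for t H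
  proof -
    have "(\<lambda>\<omega>. (\<beta> t \<omega>, xi t \<omega>)) \<in> measurable H (restrict_space borel ?S \<Otimes>\<^sub>M borel)"
      by (intro measurable_Pair measurable_restrict_space2 that) (use \<beta>_in in auto)
    from measurable_compose[OF this G_meas] show ?thesis
      by simp
  qed
  have \<beta>_meas: "\<beta> t \<in> borel_measurable (?F t)" for t
  proof (induction t)
    case (Suc t)
    have sub: "subalgebra (?F (Suc t)) (?F t)"
      by (rule subalgebra_sample_algebra_mono) auto
    show ?case
      unfolding \<beta>_Suc
      by (intro measurable_update grad_meas \<beta>_in measurable_from_subalg[OF sub Suc]
          measurable_sample_index measurable_sample) auto
  qed (simp add: \<beta>_0)
  have G_meas': "(\<lambda>\<omega>. G (\<beta> t \<omega>) (xi t \<omega>)) \<in> borel_measurable (?G t)" for t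
    by (intro grad_meas measurable_from_subalg[OF GF \<beta>_meas] measurable_sample) auto
  have a_meas: "(\<lambda>\<omega>. gradF (\<beta> t \<omega>)) \<in> borel_measurable (?F t)" for t
    by (rule measurable_continuous_comp[OF \<beta>_meas \<beta>_in gradF_cont])
  have z_meas: "z t \<in> borel_measurable M" for t
    unfolding z_def[abs_def]
    using measurable_from_subalg[OF MG G_meas'] measurable_from_subalg[OF MF a_meas] by measurable
  have z_var': "AE \<omega> in M. nn_cond_exp M (?F t) (\<lambda>\<omega>. ennreal ((nb.dual i (block c i (z t \<omega>)))\<^sup>2)) \<omega>
      \<le> ennreal ((\<nu> i)\<^sup>2)" for t i
    using z_var[of i] by eventually_elim blast
  have z_int: "integrable M (\<lambda>\<omega>. (nb.dual i (block c i (z t \<omega>)))\<^sup>2)" for t i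
    by (rule integrable_of_nn_cond_exp_le[OF prob MF _ _ z_var'])
      (use measurable_dual[OF z_meas] in auto)
  have indep: "prob ({\<omega> \<in> space M. ix t \<omega> = i} \<inter> A) = p i * prob A" if "A \<in> sets (?G t)" for t i A
  proof -
    have "{\<omega> \<in> space M. ix t \<omega> = i} = ix t -` {i} \<inter> space M"
      by auto
    also have "\<dots> \<in> sets (sample_algebra M ix xi {t} {})"
      unfolding sets_sample_algebra by (intro sigma_sets.Basic) blast
    finally show ?thesis
      using indep_setD[OF ix_indep _ that] ix_prob by simp
  qed
  define X where "X t \<omega> = error_fun c p w dw (\<beta> t \<omega>) \<beta>star" for t \<omega>
  have step: "integrable M (X (Suc t)) \<and> (AE \<omega> in M. real_cond_exp M (?F t) (X (Suc t)) \<omega> \<le> X t \<omega>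
      + (\<Sum>i\<in>UNIV. \<eta> t * (block c i (gradF (\<beta> t \<omega>) - u) \<bullet> block c i (\<beta>star - \<beta> t \<omega>))
          + (\<eta> t)\<^sup>2 / \<mu>\<omega> i * ((\<nu> i)\<^sup>2 + (nb.dual i (block c i (gradF (\<beta> t \<omega>) - u)))\<^sup>2)))"
    if X_int: "integrable M (X t)" for t
  proof -
    \<comment> \<open>The Lipschitz condition and strong convexity of the mirror maps dominate the
      squared dual norm by a multiple of \<open>X t\<close>, which is integrable by
      assumption.\<close>
    have h_int: "integrable M (\<lambda>\<omega>. (nb.dual i (block c i (gradF (\<beta> t \<omega>) - u)))\<^sup>2)" for i
    proof (rule Bochner_Integration.integrable_bound)
      let ?K = "LF\<^sup>2 * (2 * Max (range p) / Min (range \<mu>\<omega>))"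
      show "integrable M (\<lambda>\<omega>. ?K * X t \<omega>)"
        using X_int by simp
      have "(nb.dual i (block c i (gradF (\<beta> t \<omega>) - u)))\<^sup>2 \<le> ?K * X t \<omega>" for \<omega>
      proof -
        have "(nb.dual i (block c i (gradF (\<beta> t \<omega>) - u)))\<^sup>2
            \<le> (\<Sum>k\<in>UNIV. (nb.dual k (block c k (gradF (\<beta> t \<omega>) - u)))\<^sup>2)"
          by (rule member_le_sum) auto
        also have "\<dots> \<le> (full.dual (gradF (\<beta> t \<omega>) - u))\<^sup>2"
          by (rule sum_dual_block_sq_le)
        also have "\<dots> \<le> (LF * block_norm c N (\<beta> t \<omega> - \<beta>star))\<^sup>2"
          unfolding u_def by (intro power_mono F_lip \<beta>_in y full.dual_nonneg)
        also have "\<dots> \<le> ?K * X t \<omega>"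
          using mult_left_mono[OF block_norm_sq_le_error_fun[OF \<beta>_in y], of "LF\<^sup>2" t \<omega>]
          by (simp add: power_mult_distrib X_def mult.assoc)
        finally show ?thesis .
      qed
      then show "AE \<omega> in M. norm ((nb.dual i (block c i (gradF (\<beta> t \<omega>) - u)))\<^sup>2) \<le> norm (?K * X t \<omega>)"
        unfolding real_norm_def abs_power2 by (intro AE_I2 order_trans[OF _ abs_ge_self])
      show "(\<lambda>\<omega>. (nb.dual i (block c i (gradF (\<beta> t \<omega>) - u)))\<^sup>2) \<in> borel_measurable M"
        using measurable_from_subalg[OF MF a_meas]
        by (intro borel_measurable_power measurable_dual borel_measurable_diff) auto
    qed
    have mean: "AE \<omega> in M. real_cond_exp M (?F t)
        (\<lambda>\<omega>. (G (\<beta> t \<omega>) (xi t \<omega>) - gradF (\<beta> t \<omega>)) $ j) \<omega> = 0" for j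
      unfolding z_def[symmetric] using z_mean by eventually_elim blast
    have var: "AE \<omega> in M. real_cond_exp M (?F t)
        (\<lambda>\<omega>. (nb.dual i (block c i (G (\<beta> t \<omega>) (xi t \<omega>) - gradF (\<beta> t \<omega>))))\<^sup>2) \<omega> \<le> (\<nu> i)\<^sup>2" for i
      unfolding z_def[symmetric] by (intro real_cond_exp_le_of_nn_cond_exp_le z_var') auto
    note * = conditional_step[OF prob MG GF ix_rv ix_prob indep \<beta>_meas \<beta>_in G_meas' a_meas y u \<eta>_pos
        X_int[unfolded X_def] z_int[unfolded z_def] h_int mean var]
    show ?thesis
      unfolding X_def \<beta>_Suc using * by (intro conjI) assumption+
  qed
  have X_int: "integrable M (X t)" for t
  proof (induction t)
    case 0
    show ?case by (simp add: X_def \<beta>_0)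
  next
    case (Suc t)
    then show ?case using step by blast
  qed
  have bound: "AE \<omega> in M. real_cond_exp M (?F t) (X (Suc t)) \<omega>
      \<le> (1 - \<eta> t * (2 * \<mu>F * Min (range p) / Max (range L\<omega>))
          + (\<eta> t)\<^sup>2 * (2 * LF\<^sup>2 * Max (range p) / (Min (range \<mu>\<omega>))\<^sup>2)) * X t \<omega>
        + (\<eta> t)\<^sup>2 * (\<Sum>i\<in>UNIV. (\<nu> i)\<^sup>2 / \<mu>\<omega> i)" for t
    using step[OF X_int, of t, THEN conjunct2]
  proof eventually_elim
    case (elim \<omega>)
    \<comment> \<open>Adding the strong convexity inequalities of \<open>F\<close> in both
      directions cancels the function values, and the two halves of \<open>\<mu>F\<close> make a
      whole.\<close>
    have mono: "\<mu>F * (block_norm c N (\<beta> t \<omega> - \<beta>star))\<^sup>2 \<le> (gradF (\<beta> t \<omega>) - u) \<bullet> (\<beta> t \<omega> - \<beta>star)"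
      using F_strong[OF \<beta>_in y, of t \<omega>] F_strong[OF y \<beta>_in, of t \<omega>]
        full.N_minus_commute[of "\<beta> t \<omega>" \<beta>star]
      by (simp add: u_def algebra_simps)
    have lip: "full.dual (gradF (\<beta> t \<omega>) - u) \<le> LF * block_norm c N (\<beta> t \<omega> - \<beta>star)"
      unfolding u_def by (rule F_lip[OF \<beta>_in y])
    show ?case
      using order_trans[OF elim contraction[OF \<beta>_in y w_smooth mono lip \<mu>F_pos \<eta>_pos, folded X_def]] .
  qed
  show ?thesis
    using X_int bound unfolding X_def[symmetric, abs_def] AE_all_countable by blast
qed

end
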